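(* Let $G=(V,E)$ be a strongly connected digraph with $V=\{1,\dots,N\}$ and out-degrees $d_w\ge 2$ for all $w\in V$, and suppose $u\in V$ is a vertex such that some directed circuit of $G$ does not pass through $u$. Let $n=2\#E-\#V$, and let $P\subset\mathbb{R}^n$ and the admissible set $\mathcal{A}\subset P$ be as defined in the context. If $x\in\mathcal{A}$ then, for every vector $\mathbf{b}=(b_i^{(1)})_{i\in V}\in\mathbb{R}^N$, the attractor $F_u$ at $u$ of the GD-IFS $\digamma(x,\mathbf{b})$ (defined in the context) is not the attractor of any standard IFS on $\mathbb{R}$ satisfying the COSC. Moreover $\mathcal{L}^n(P\setminus\mathcal{A})=0$, where $\mathcal{L}^n$ is $n$-dimensional Lebesgue measure.
   Context: **Digraphs.** A digraph $G=(V,E)$ has finitely many vertices and directed edges (loops and multiple edges allowed). $E_{uv}$ is the set of edges from $u$ to $v$, $\omega(e)$ is the terminal vertex of the edge $e$, and $d_u$ is the number of edges leaving $u$. A directed path is a finite sequence $e_1\cdots e_k$ ($k\ge1$) of edges with the terminal vertex of $e_i$ equal to the initial vertex of $e_{i+1}$; a directed circuit is a directed path whose initial and terminal vertices coincide. $G$ is strongly connected if for all $u,v\in V$ (including $u=v$) there is a directed path from $u$ to $v$. **GD-IFS.** A GD-IFS on $\mathbb{R}$ based on $G$ is a family $(S_e)_{e\in E}$ of contracting similarities of $\mathbb{R}$, $S_e(t)=\rho_e t+c_e$ with $\rho_e\in(-1,1)\setminus\{0\}$. Its attractors are the unique nonempty compact sets $(F_u)_{u\in V}$ with $F_u=\bigcup_{v\in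 V}\bigcup_{e\in E_{uv}}S_e(F_v)$ for all $u\in V$. **Standard IFS.** A standard IFS on $\mathbb{R}$ is a finite set of distinct contracting similarities $\{S_i\}$ of $\mathbb{R}$ (ratios in $(-1,1)\setminus\{0\}$); its attractor is the unique nonempty compact $K$ with $K=\bigcup_i S_i(K)$. It satisfies the COSC (convex open set condition) if there is a nonempty convex open set $U$ with $\bigcup_i S_i(U)\subseteq U$, the union being disjoint (equivalently one can take $U=\mathrm{int}(\mathrm{conv}\,K)$). **The parameter sets.** For each $i\in V$ fix an ordering $e_i(1),\dots,e_i(d_i)$ of the edges leaving $i$. $P_0\subset\mathbb{R}^n$, $n=2\#E-\#V=2(d_1+\dots+d_N)-N$, is the set of vectors $$x=(x_1^{(1)},\dots,x_1^{(d_1)},\dots,x_N^{(1)},\dots,x_N^{(d_N)},\xi_1^{(1)},\dots,\xi_1^{(d_1-1)},\dots,\xi_N^{(1)},\dots,\xi_N^{(d_N-1)})$$ with all $x_i^{(k)}\in(-1,1)\setminus\{0\}$ and all $\xi_i^{(k)}\ge0$. For $x\in P_0$, $M_x(1)$ is the $N\times N$ matrix with $(i,j)$ entry $\sum_{k:\,e_i(k)\in E_{ij}}|x_i^{(k)}|$ (equal to $0$ if $E_{ij}=\emptyset$), and $r_\sigma$ denotes spectral radius. Put $$P=\Big\{x\in P_0: r_\sigma(M_x(1))<1,\ \sum_{k=1}^{d_i-1}\xi_i^{(k)}>0\text{ for all } i\in V\Big\},$$ $$P_1=\{x\in P_0: r_\sigma(M_x(1))<1,\ \xi_i^{(k)}>0\text{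 for all } i\in V,\ 1\le k\le d_i-1\}\subset P.$$ Writing the entries of $x\in P_1$ as $(x_1,\dots,x_n)$, $x$ is admissible if $\prod_{i=1}^n|x_i|^{p_i}\ne\prod_{i=1}^n|x_i|^{q_i}$ for any two distinct vectors $(p_i)_{i=1}^n$, $(q_i)_{i=1}^n$ of nonnegative rationals. $\mathcal{A}$ is the set of admissible points of $P_1$. **The GD-IFS $\digamma(x,\mathbf{b})$.** For $x\in P$ and $\mathbf{b}=(b_i^{(1)})_{i\in V}\in\mathbb{R}^N$, define $(l_i)_{i\in V}$ by $(l_i)_{i\in V}^T=(\mathrm{id}-M_x(1))^{-1}\big(\sum_{k=1}^{d_i-1}\xi_i^{(k)}\big)_{i\in V}^T$, define $b_i^{(k+1)}=b_i^{(k)}+|x_i^{(k)}|\,l_{\omega(e_i(k))}+\xi_i^{(k)}$ for $i\in V$, $1\le k\le d_i-1$, and let $\digamma(x,\mathbf{b})=\{S_{e_i(k)}: i\in V,\,1\le k\le d_i\}$ with $$S_{e_i(k)}(t)=x_i^{(k)}\big(t-b^{(1)}_{\omega(e_i(k))}\big)+b_i^{(k)}-x_i^{(k)}\,l_{\omega(e_i(k))}\mathbf{1}_{\{x_i^{(k)}<0\}}\qquad(t\in\mathbb{R}),$$ where $\mathbf{1}_{\{x_i^{(k)}<0\}}$ is $1$ if $x_i^{(k)}<0$ and $0$ otherwise. *)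

theory Defs
  imports
    "HOL-Analysis.Analysis"
    "Graph_Theory.Arc_Walk"
    "Jordan_Normal_Form.Gauss_Jordan_Elimination"
    "Jordan_Normal_Form.Spectral_Radius"
begin

section \<open>Digraphs\<close>

text \<open>
  Finite digraphs with loops and multiple edges are \<^locale>\<open>fin_digraph\<close>s. A directed path is a
  nonempty arc walk; note that \<open>strongly_connected\<close> of the digraph library also admits
  empty walks, whereas here a path of positive length is required even from a vertex to itself.
\<close>

definition directed_path :: "('v, 'e) pre_digraph \<Rightarrow> 'v \<Rightarrow> 'e list \<Rightarrow> 'v \<Rightarrow> bool" where
  "directed_path G v p w \<longleftrightarrow> p \<noteq> [] \<and> pre_digraph.awalk G v p w"

definition strongly_conn :: "('v, 'e) pre_digraph \<Rightarrow> bool" where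
  "strongly_conn G \<longleftrightarrow> (\<forall>v\<in>verts G. \<forall>w\<in>verts G. \<exists>p. directed_path G v p w)"

definition passes_through :: "('v, 'e) pre_digraph \<Rightarrow> 'e list \<Rightarrow> 'v \<Rightarrow> bool" where
  "passes_through G p u \<longleftrightarrow> (\<exists>a\<in>set p. tail G a = u \<or> head G a = u)"

definition edge_ordering :: "('v, 'e) pre_digraph \<Rightarrow> ('v \<Rightarrow> nat \<Rightarrow> 'e) \<Rightarrow> bool" where
  "edge_ordering G e \<longleftrightarrow> (\<forall>i\<in>verts G. bij_betw (e i) {1..out_degree G i} (out_arcs G i))"


section \<open>Iterated function systems on the line\<close>

definition contracting_similarity :: "(real \<Rightarrow> real) \<Rightarrow> bool" where
  "contracting_similarity f \<longleftrightarrow> (\<exists>\<rho> c. \<rho> \<in> {-1<..<1} - {0} \<and> f = (\<lambda>t. \<rho> * t + c))"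

definition gd_ifs :: "('v, 'e) pre_digraph \<Rightarrow> ('e \<Rightarrow> real \<Rightarrow> real) \<Rightarrow> bool" where
  "gd_ifs G S \<longleftrightarrow> (\<forall>a\<in>arcs G. contracting_similarity (S a))"

definition gd_attractor ::
    "('v, 'e) pre_digraph \<Rightarrow> ('e \<Rightarrow> real \<Rightarrow> real) \<Rightarrow> ('v \<Rightarrow> real set) \<Rightarrow> bool" where
  "gd_attractor G S F \<longleftrightarrow>
     (\<forall>u\<in>verts G. F u \<noteq> {} \<and> compact (F u) \<and>
        F u = (\<Union>v\<in>verts G. \<Union>a\<in>{a \<in> arcs G. tail G a = u \<and> head G a = v}. S a ` F v))"

definition standard_ifs :: "(real \<Rightarrow> real) set \<Rightarrow> bool" where
  "standard_ifs I \<longleftrightarrow> finite I \<and> (\<forall>f\<in>I. contracting_similarity f)"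

definition ifs_attractor :: "(real \<Rightarrow> real) set \<Rightarrow> real set \<Rightarrow> bool" where
  "ifs_attractor I K \<longleftrightarrow> K \<noteq> {} \<and> compact K \<and> K = (\<Union>f\<in>I. f ` K)"

definition COSC :: "(real \<Rightarrow> real) set \<Rightarrow> bool" where
  "COSC I \<longleftrightarrow> (\<exists>U. U \<noteq> {} \<and> convex U \<and> open U \<and> (\<Union>f\<in>I. f ` U) \<subseteq> U \<and>
     disjoint_family_on (\<lambda>f. f ` U) I)"


section \<open>The parameter sets\<close>

text \<open>
  \<open>Ratio i k\<close> is the position of \<open>x\<^sub>i\<^sup>(\<^sup>k\<^sup>)\<close> and \<open>Gap i k\<close> that of \<open>\<xi>\<^sub>i\<^sup>(\<^sup>k\<^sup>)\<close> in a parameter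
  vector. Euclidean space of dimension \<open>n = 2 #E - #V\<close> is rendered as the space of extensional
  real functions on the finite set \<open>coords G\<close> of positions, which has \<open>n\<close> elements
  (\<open>card_coords\<close> below).
\<close>

datatype coord = Ratio nat nat | Gap nat nat

definition coords :: "(nat, 'e) pre_digraph \<Rightarrow> coord set" where
  "coords G = {Ratio i k | i k. i \<in> verts G \<and> k \<in> {1..out_degree G i}} \<union>
              {Gap i k | i k. i \<in> verts G \<and> k \<in> {1..out_degree G i - 1}}"

definition P0 :: "(nat, 'e) pre_digraph \<Rightarrow> (coord \<Rightarrow> real) set" where
  "P0 G = {x \<in> coords G \<rightarrow>\<^sub>E UNIV.
     (\<forall>i\<in>verts G. \<forall>k\<in>{1..out_degree G i}. x (Ratio i k) \<in> {-1<..<1} - {0}) \<and>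
     (\<forall>i\<in>verts G. \<forall>k\<in>{1..out_degree G i - 1}. x (Gap i k) \<ge> 0)}"

text \<open>
  The vertices are \<open>1, \<dots>, N\<close>, but matrices and vectors are indexed from \<open>0\<close>: row and column \<open>i\<close>
  belong to the vertex \<open>Suc i\<close>.
\<close>

definition M1 :: "(nat, 'e) pre_digraph \<Rightarrow> (nat \<Rightarrow> nat \<Rightarrow> 'e) \<Rightarrow> (coord \<Rightarrow> real) \<Rightarrow> real mat" where
  "M1 G e x = Matrix.mat (card (verts G)) (card (verts G)) (\<lambda>(i, j).
     \<Sum>k\<in>{k \<in> {1..out_degree G (Suc i)}. head G (e (Suc i) k) = Suc j}. \<bar>x (Ratio (Suc i) k)\<bar>)"

definition P :: "(nat, 'e) pre_digraph \<Rightarrow> (nat \<Rightarrow> nat \<Rightarrow> 'e) \<Rightarrow> (coord \<Rightarrow> real) set" where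
  "P G e = {x \<in> P0 G. spectral_radius (map_mat complex_of_real (M1 G e x)) < 1 \<and>
     (\<forall>i\<in>verts G. (\<Sum>k\<in>{1..out_degree G i - 1}. x (Gap i k)) > 0)}"

definition P1 :: "(nat, 'e) pre_digraph \<Rightarrow> (nat \<Rightarrow> nat \<Rightarrow> 'e) \<Rightarrow> (coord \<Rightarrow> real) set" where
  "P1 G e = {x \<in> P0 G. spectral_radius (map_mat complex_of_real (M1 G e x)) < 1 \<and>
     (\<forall>i\<in>verts G. \<forall>k\<in>{1..out_degree G i - 1}. x (Gap i k) > 0)}"

definition admissible :: "(nat, 'e) pre_digraph \<Rightarrow> (coord \<Rightarrow> real) \<Rightarrow> bool" where
  "admissible G x \<longleftrightarrow>
     (\<forall>p q :: coord \<Rightarrow> rat.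
        (\<forall>c\<in>coords G. p c \<ge> 0 \<and> q c \<ge> 0) \<and> (\<exists>c\<in>coords G. p c \<noteq> q c) \<longrightarrow>
        (\<Prod>c\<in>coords G. \<bar>x c\<bar> powr of_rat (p c)) \<noteq> (\<Prod>c\<in>coords G. \<bar>x c\<bar> powr of_rat (q c)))"

definition Adm :: "(nat, 'e) pre_digraph \<Rightarrow> (nat \<Rightarrow> nat \<Rightarrow> 'e) \<Rightarrow> (coord \<Rightarrow> real) set" where
  "Adm G e = {x \<in> P1 G e. admissible G x}"

definition lebesgue_coords :: "(nat, 'e) pre_digraph \<Rightarrow> (coord \<Rightarrow> real) measure" where
  "lebesgue_coords G = completion (\<Pi>\<^sub>M c\<in>coords G. lborel)"


section \<open>The graph-directed system of a parameter vector\<close>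

text \<open>\<open>seg_len G e x i\<close> is \<open>l\<^sub>i\<close>.\<close>

definition seg_len ::
    "(nat, 'e) pre_digraph \<Rightarrow> (nat \<Rightarrow> nat \<Rightarrow> 'e) \<Rightarrow> (coord \<Rightarrow> real) \<Rightarrow> nat \<Rightarrow> real" where
  "seg_len G e x i =
     vec_index
       (the (mat_inverse (1\<^sub>m (card (verts G)) - M1 G e x)) *\<^sub>v
        Matrix.vec (card (verts G)) (\<lambda>j. \<Sum>k\<in>{1..out_degree G (Suc j) - 1}. x (Gap (Suc j) k)))
       (i - 1)"

text \<open>\<open>left_pt G e x b i k\<close> is \<open>b\<^sub>i\<^sup>(\<^sup>k\<^sup>)\<close> for \<open>k \<ge> 1\<close>; the value at \<open>k = 0\<close> plays no role.\<close>

fun left_pt ::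
    "(nat, 'e) pre_digraph \<Rightarrow> (nat \<Rightarrow> nat \<Rightarrow> 'e) \<Rightarrow> (coord \<Rightarrow> real) \<Rightarrow> (nat \<Rightarrow> real) \<Rightarrow>
     nat \<Rightarrow> nat \<Rightarrow> real" where
  "left_pt G e x b i 0 = 0"
| "left_pt G e x b i (Suc 0) = b i"
| "left_pt G e x b i (Suc (Suc k)) =
     left_pt G e x b i (Suc k)
     + \<bar>x (Ratio i (Suc k))\<bar> * seg_len G e x (head G (e i (Suc k))) + x (Gap i (Suc k))"

definition gd_map ::
    "(nat, 'e) pre_digraph \<Rightarrow> (nat \<Rightarrow> nat \<Rightarrow> 'e) \<Rightarrow> (coord \<Rightarrow> real) \<Rightarrow> (nat \<Rightarrow> real) \<Rightarrow>
     'e \<Rightarrow> real \<Rightarrow> real" where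
  "gd_map G e x b a =
     (let i = tail G a;
          j = head G a;
          k = the_inv_into {1..out_degree G i} (e i) a;
          r = x (Ratio i k)
      in (\<lambda>t. r * (t - b j) + left_pt G e x b i k - r * seg_len G e x j * of_bool (r < 0)))"


section \<open>Dimension of the parameter space; existence and uniqueness of attractors\<close>

lemma card_coords:
  assumes "fin_digraph G" and "\<forall>i\<in>verts G. out_degree G i \<ge> 1"
  shows "finite (coords G)" and "card (coords G) = 2 * card (arcs G) - card (verts G)"
proof -
  interpret fin_digraph G by fact
  let ?A = "SIGMA i:verts G. {1..out_degree G i}"
  let ?B = "SIGMA i:verts G. {1..out_degree G i - 1}"
  have c: "coords G = case_prod Ratio ` ?A \<union> case_prod Gap ` ?B"
    by (auto simp: coords_def image_iff)
  show "finite (coords G)" unfolding c by (intro finite_UnI finite_imageI finite_SigmaI) simp_all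
  have u: "arcs G = (\<Union>i\<in>verts G. out_arcs G i)"
    by auto
  have "card (\<Union>i\<in>verts G. out_arcs G i) = (\<Sum>i\<in>verts G. card (out_arcs G i))"
    by (rule card_UN_disjoint) auto
  hence s: "card (arcs G) = (\<Sum>i\<in>verts G. out_degree G i)"
    by (simp only: u[symmetric] out_degree_def)
  have "card (coords G) = card (case_prod Ratio ` ?A) + card (case_prod Gap ` ?B)"
    unfolding c
    by (rule card_Un_disjoint; (intro finite_imageI finite_SigmaI)?) auto
  also have "\<dots> = card ?A + card ?B"
  proof -
    have "inj_on (case_prod Ratio) ?A" "inj_on (case_prod Gap) ?B"
      by (auto simp: inj_on_def)
    thus ?thesis by (simp only: card_image)
  qed
  also have "\<dots> = (\<Sum>i\<in>verts G. out_degree G i) + (\<Sum>i\<in>verts G. out_degree G i - 1)"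
    by simp
  also have "(\<Sum>i\<in>verts G. out_degree G i - 1) = (\<Sum>i\<in>verts G. out_degree G i) - card (verts G)"
    using assms(2) by (subst sum_subtractf_nat) auto
  finally show "card (coords G) = 2 * card (arcs G) - card (verts G)"
    using s assms(2) sum_mono[of "verts G" "\<lambda>_. 1" "out_degree G"] by simp
qed

lemma gd_ifs_gd_map:
  assumes "fin_digraph G" "edge_ordering G e" "x \<in> P G e"
  shows "gd_ifs G (gd_map G e x b)"
  unfolding gd_ifs_def
proof
  interpret fin_digraph G by fact
  fix a assume a: "a \<in> arcs G"
  define i where "i = tail G a"
  define k where "k = the_inv_into {1..out_degree G i} (e i) a"
  define r where "r = x (Ratio i k)"
  have i: "i \<in> verts G" using a by (simp add: i_def)
  have "bij_betw (e i) {1..out_degree G i} (out_arcs G i)"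
    using assms(2) i by (simp add: edge_ordering_def)
  moreover have "a \<in> out_arcs G i" using a by (simp add: i_def)
  ultimately have "k \<in> {1..out_degree G i}"
    unfolding k_def bij_betw_def by (intro the_inv_into_into) auto
  hence r: "r \<in> {-1<..<1} - {0}"
    using assms(3) i by (auto simp: P_def P0_def r_def)
  have "gd_map G e x b a = (\<lambda>t. r * t + (left_pt G e x b i k - r * b (head G a)
          - r * seg_len G e x (head G a) * of_bool (r < 0)))"
    by (rule ext) (simp only: gd_map_def Let_def i_def[symmetric] k_def[symmetric] r_def[symmetric],
        simp add: algebra_simps)
  thus "contracting_similarity (gd_map G e x b a)"
    using r unfolding contracting_similarity_def by blast
qed

lemma gd_attractor_exists:
  assumes "fin_digraph G" "\<forall>i\<in>verts G. out_degree G i \<ge> 1" "gd_ifs G S"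
  shows "\<exists>F. gd_attractor G S F"
proof -
  interpret fin_digraph G by fact
  obtain r c where rc: "\<And>a. a \<in> arcs G \<Longrightarrow> \<bar>r a\<bar> < 1"
      "\<And>a. a \<in> arcs G \<Longrightarrow> r a \<noteq> 0" "\<And>a. a \<in> arcs G \<Longrightarrow> S a = (\<lambda>t. r a * t + c a)"
  proof -
    have "\<forall>a\<in>arcs G. \<exists>\<rho> c. \<bar>\<rho>\<bar> < 1 \<and> \<rho> \<noteq> 0 \<and> S a = (\<lambda>t. \<rho> * t + c)"
      using assms(3) unfolding gd_ifs_def contracting_similarity_def
      by (metis Diff_iff abs_less_iff greaterThanLessThan_iff insertI1 minus_less_iff)
    thus ?thesis using that by metis
  qed
  define R where "R = (\<Sum>a\<in>arcs G. \<bar>c a\<bar> / (1 - \<bar>r a\<bar>))"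
  have R0: "R \<ge> 0" unfolding R_def using rc(1) by (intro sum_nonneg divide_nonneg_nonneg) force+
  have R: "S a ` {-R..R} \<subseteq> {-R..R}" if a: "a \<in> arcs G" for a
  proof -
    have "\<bar>c a\<bar> / (1 - \<bar>r a\<bar>) \<le> R" unfolding R_def
      using a rc(1) by (intro member_le_sum) (auto intro!: divide_nonneg_nonneg simp: less_imp_le)
    hence cR: "\<bar>c a\<bar> \<le> R * (1 - \<bar>r a\<bar>)" using rc(1)[OF a] by (simp add: pos_divide_le_eq)
    have "\<bar>r a * t + c a\<bar> \<le> R" if "\<bar>t\<bar> \<le> R" for t
    proof -
      have "\<bar>r a * t + c a\<bar> \<le> \<bar>r a\<bar> * \<bar>t\<bar> + \<bar>c a\<bar>" by (metis abs_mult abs_triangle_ineq)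
      also have "\<dots> \<le> \<bar>r a\<bar> * R + \<bar>c a\<bar>" using that by (simp add: mult_left_mono)
      also have "\<dots> \<le> R" using cR by (simp add: algebra_simps)
      finally show ?thesis .
    qed
    thus ?thesis unfolding rc(3)[OF a]
      by (intro image_subsetI) (metis abs_le_iff atLeastAtMost_iff minus_le_iff)
  qed
  define \<Phi> where "\<Phi> A u = (\<Union>a\<in>out_arcs G u. S a ` A (head G a))" for A u
  define A where "A n = (\<Phi> ^^ n) (\<lambda>_. {-R..R})" for n
  have A0: "A 0 u = {-R..R}" for u by (simp add: A_def)
  have AS: "A (Suc n) u = (\<Union>a\<in>out_arcs G u. S a ` A n (head G a))" for n u
    by (simp add: A_def \<Phi>_def)
  have dec1: "A (Suc n) u \<subseteq> A n u" for n u
  proof (induction n arbitrary: u)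
    case 0
    show ?case unfolding AS A0 using R by (intro UN_least) simp
  next
    case (Suc n)
    show ?case by (subst (1 2) AS) (intro UN_mono image_mono Suc.IH subset_refl)
  qed
  have dec: "A n u \<subseteq> A m u" if "m \<le> n" for m n u
    by (rule lift_Suc_antimono_le[of "\<lambda>n. A n u"]) (use dec1 that in auto)
  have cont: "continuous_on T (S a)" if "a \<in> arcs G" for a T
    unfolding rc(3)[OF that] by (intro continuous_intros)
  have AN: "A n u \<noteq> {} \<and> compact (A n u)" if "u \<in> verts G" for n u
    using that
  proof (induction n arbitrary: u)
    case 0
    then show ?case using R0 by (simp add: A0)
  next
    case (Suc n)
    have h: "A n (head G a) \<noteq> {}" "compact (A n (head G a))" if "a \<in> out_arcs G u" for a
      using Suc.IH[of "head G a"] that by auto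
    have "out_degree G u \<noteq> 0"
      using assms(2) Suc.prems by fastforce
    hence o: "out_arcs G u \<noteq> {}" unfolding out_degree_def by (metis card.empty)
    have "(\<Union>a\<in>out_arcs G u. S a ` A n (head G a)) \<noteq> {}"
    proof -
      obtain a where a: "a \<in> out_arcs G u" using o by (meson ex_in_conv)
      obtain t where t: "t \<in> A n (head G a)" using h(1)[OF a] by (meson ex_in_conv)
      have "S a t \<in> (\<Union>a\<in>out_arcs G u. S a ` A n (head G a))"
        by (rule UN_I[OF a], rule imageI[OF t])
      thus ?thesis by (rule ex_in_conv[THEN iffD1, OF exI])
    qed
    moreover have "compact (\<Union>a\<in>out_arcs G u. S a ` A n (head G a))"
    proof (rule compact_UN)
      show "finite (out_arcs G u)" by (rule finite_out_arcs)
      show "compact (S a ` A n (head G a))" if "a \<in> out_arcs G u" for a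
        using that h(2)[OF that] by (intro compact_continuous_image cont) simp_all
    qed
    ultimately show ?case unfolding AS by (rule conjI)
  qed
  define F where "F u = (\<Inter>n. A n u)" for u
  have ne: "F u \<noteq> {}" if "u \<in> verts G" for u
    unfolding F_def using AN[OF that] dec by (intro compact_nest) auto
  have co: "compact (F u)" if "u \<in> verts G" for u
    unfolding F_def using AN[OF that] by (intro compact_Inter) auto
  have eq: "F u = (\<Union>a\<in>out_arcs G u. S a ` F (head G a))" if u: "u \<in> verts G" for u
  proof
    show "(\<Union>a\<in>out_arcs G u. S a ` F (head G a)) \<subseteq> F u"
    proof
      fix y assume "y \<in> (\<Union>a\<in>out_arcs G u. S a ` F (head G a))"
      then obtain a t where at: "a \<in> out_arcs G u" "y = S a t" "\<And>n. t \<in> A n (head G a)"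
        by (auto simp: F_def)
      have "y \<in> A (Suc n) u" for n unfolding AS using at by blast
      hence "y \<in> A n u" for n by (rule subsetD[OF dec1])
      thus "y \<in> F u" unfolding F_def by (rule INT_I)
    qed
    show "F u \<subseteq> (\<Union>a\<in>out_arcs G u. S a ` F (head G a))"
    proof
      fix y assume y: "y \<in> F u"
      have "\<exists>a. a \<in> out_arcs G u \<and> y \<in> S a ` A n (head G a)" for n
      proof -
        have "y \<in> A (Suc n) u" using y unfolding F_def by (rule INT_D) simp
        thus ?thesis unfolding AS UN_iff Bex_def .
      qed
      then obtain g where g: "\<And>n. g n \<in> out_arcs G u \<and> y \<in> S (g n) ` A n (head G (g n))"
        by metis
      have "range g \<subseteq> out_arcs G u" using g by blast
      hence "finite (range g)" using finite_out_arcs finite_subset by blast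
      then obtain n0 where inf: "infinite {n. g n = g n0}"
        using pigeonhole_infinite[of "UNIV :: nat set" g] by auto
      define a where "a = g n0"
      have a: "a \<in> arcs G" "a \<in> out_arcs G u" using g[of n0] by (auto simp: a_def)
      define t where "t = (y - c a) / r a"
      have yt: "y = S a t" using rc(2,3)[OF a(1)] by (simp add: t_def)
      have "t \<in> A n (head G a)" for n
      proof -
        obtain m where m: "m \<ge> n" "g m = a"
          using inf unfolding a_def infinite_nat_iff_unbounded_le by blast
        obtain s where s: "y = S a s" "s \<in> A m (head G a)" using g[of m] m by auto
        have "s = t" using s(1) yt rc(2,3)[OF a(1)] by simp
        thus ?thesis using s(2) dec[OF m(1)] by blast
      qed
      thus "y \<in> (\<Union>a\<in>out_arcs G u. S a ` F (head G a))"
        using UN_I[OF a(2), of y "\<lambda>a. S a ` F (head G a)"] yt by (simp add: F_def)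
    qed
  qed
  have "F u = (\<Union>v\<in>verts G. \<Union>a\<in>{a \<in> arcs G. tail G a = u \<and> head G a = v}. S a ` F v)"
    if "u \<in> verts G" for u
  proof -
    have "(\<Union>a\<in>out_arcs G u. S a ` F (head G a)) =
        (\<Union>v\<in>verts G. \<Union>a\<in>{a \<in> arcs G. tail G a = u \<and> head G a = v}. S a ` F v)"
      by (fastforce simp: out_arcs_def)
    with eq[OF that] show ?thesis by (rule trans)
  qed
  hence "gd_attractor G S F"
    unfolding gd_attractor_def using ne co by (intro ballI conjI)
  thus ?thesis by (rule exI[where x = F])
qed

lemma gd_attractor_subset:
  assumes "fin_digraph G" "gd_ifs G S" "gd_attractor G S F" "gd_attractor G S F'" "w \<in> verts G"
  shows "F w \<subseteq> F' w"
proof -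
  interpret fin_digraph G by fact
  have F: "F v \<noteq> {}" "compact (F v)"
      "F v = (\<Union>j\<in>verts G. \<Union>a\<in>{a \<in> arcs G. tail G a = v \<and> head G a = j}. S a ` F j)"
    and F': "F' v \<noteq> {}" "compact (F' v)"
      "F' v = (\<Union>j\<in>verts G. \<Union>a\<in>{a \<in> arcs G. tail G a = v \<and> head G a = j}. S a ` F' j)"
    if "v \<in> verts G" for v
    by (fact conjunct1[OF assms(3)[unfolded gd_attractor_def, rule_format, OF that]]
        conjunct1[OF conjunct2[OF assms(3)[unfolded gd_attractor_def, rule_format, OF that]]]
        conjunct2[OF conjunct2[OF assms(3)[unfolded gd_attractor_def, rule_format, OF that]]]
        conjunct1[OF assms(4)[unfolded gd_attractor_def, rule_format, OF that]]
        conjunct1[OF conjunct2[OF assms(4)[unfolded gd_attractor_def, rule_format, OF that]]]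
        conjunct2[OF conjunct2[OF assms(4)[unfolded gd_attractor_def, rule_format, OF that]]])+
  have "\<exists>t\<in>F v. \<forall>s\<in>F v. infdist s (F' v) \<le> infdist t (F' v)" if "v \<in> verts G" for v
    by (rule continuous_attains_sup[OF F(2,1)[OF that]]) (intro continuous_intros)
  then obtain t where t: "\<And>v. v \<in> verts G \<Longrightarrow> t v \<in> F v"
      "\<And>v s. v \<in> verts G \<Longrightarrow> s \<in> F v \<Longrightarrow> infdist s (F' v) \<le> infdist (t v) (F' v)"
    by metis
  define d where "d v = infdist (t v) (F' v)" for v
  define D where "D = Max (d ` verts G)"
  have dD: "d v \<le> D" if "v \<in> verts G" for v
    unfolding D_def using that by (intro Max_ge) auto
  have "D \<in> d ` verts G" unfolding D_def using assms(5) by (intro Max_in) auto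
  then obtain v where v: "v \<in> verts G" "d v = D" by auto
  have D0: "D \<ge> 0" using v unfolding d_def using infdist_nonneg by metis
  from t(1)[OF v(1)] have "t v \<in> (\<Union>j\<in>verts G.
      \<Union>a\<in>{a \<in> arcs G. tail G a = v \<and> head G a = j}. S a ` F j)"
    by (rule F(3)[OF v(1), THEN equalityD1, THEN subsetD])
  then obtain a s where a: "a \<in> arcs G" "tail G a = v" "s \<in> F (head G a)" "t v = S a s"
    by auto
  have h: "head G a \<in> verts G" using a(1) by simp
  obtain \<rho> c where \<rho>: "\<bar>\<rho>\<bar> < 1" "S a = (\<lambda>t. \<rho> * t + c)"
    using assms(2) a(1) unfolding gd_ifs_def contracting_similarity_def by force
  obtain s' where s': "s' \<in> F' (head G a)" "infdist s (F' (head G a)) = dist s s'"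
    using infdist_attains_inf[OF compact_imp_closed[OF F'(2)[OF h]] F'(1)[OF h]] by blast
  have ss: "dist s s' \<le> D"
    using t(2)[OF h a(3)] dD[OF h] s'(2) by (simp add: d_def)
  have "S a s' \<in> F' v"
  proof -
    have "S a s' \<in> (\<Union>j\<in>verts G. \<Union>a\<in>{a \<in> arcs G. tail G a = v \<and> head G a = j}. S a ` F' j)"
      using a s'(1) h by blast
    thus ?thesis by (rule F'(3)[OF v(1), THEN equalityD2, THEN subsetD])
  qed
  hence "D \<le> dist (S a s) (S a s')"
    using infdist_le[of "S a s'" "F' v" "t v"] v(2) a(4) by (simp add: d_def)
  also have "\<dots> = \<bar>\<rho>\<bar> * dist s s'"
    by (simp add: \<rho>(2) dist_real_def flip: abs_mult right_diff_distrib)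
  also have "\<dots> \<le> \<bar>\<rho>\<bar> * D" using ss by (simp add: mult_left_mono)
  finally have "D * (1 - \<bar>\<rho>\<bar>) \<le> 0" by (simp add: algebra_simps)
  hence "D = 0" using \<rho>(1) D0 by (simp add: mult_le_0_iff)
  show ?thesis
  proof
    fix y assume "y \<in> F w"
    hence "infdist y (F' w) \<le> 0"
      using t(2)[OF assms(5)] dD[OF assms(5)] \<open>D = 0\<close> unfolding d_def by fastforce
    hence "infdist y (F' w) = 0" using infdist_nonneg[of y "F' w"] by linarith
    thus "y \<in> F' w"
      using in_closed_iff_infdist_zero[OF compact_imp_closed[OF F'(2)] F'(1)] assms(5) by blast
  qed
qed

lemma gd_attractor_unique:
  assumes "fin_digraph G" "gd_ifs G S" "gd_attractor G S F" "gd_attractor G S F'" "w \<in> verts G"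
  shows "F w = F' w"
  using gd_attractor_subset[OF assms] gd_attractor_subset[OF assms(1,2,4,3,5)] by blast

end

theory Submission
  imports Defs
begin

text \<open>
  The invariant that separates the two kinds of attractor is the set of gap lengths, the lengths of the
  bounded components of the complement.

  For the graph-directed system the gap lengths at \<open>u\<close> can be listed exactly
  (\<open>walk_monomial_in_gap_lengths\<close>, \<open>gap_length_walk\<close>): they are the products of the ratios along a
  walk from \<open>u\<close> to some vertex \<open>j\<close> and of one gap parameter of \<open>j\<close>. This holds since the intervals
  of level one are separated by exactly the prescribed gaps. For the attractor of a standard system with
  the COSC, the gap lengths are stable under multiplication by each contraction ratio
  (\<open>COSC_scaled_gaps\<close>), and conversely all but finitely many gap lengths are a contraction ratio times
  another gap length (\<open>COSC_gaps_decompose\<close>).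

  Suppose that one set is an attractor of both kinds and that the parameters are admissible, so that
  monomials in the parameters determine their exponents. Stability forces each contraction ratio to be
  the monomial of a closed walk at \<open>u\<close> (\<open>COSC_ratio_is_closed_walk\<close>). Going from \<open>u\<close> to the circuit that
  avoids \<open>u\<close> and running around it many times gives infinitely many gap lengths. One of these must then
  contain, as a factor, the monomial of a closed walk at \<open>u\<close>, so that its walk leaves \<open>u\<close> more often
  than needed to reach the circuit; this is a contradiction if the walk to the circuit was chosen with
  the fewest departures from \<open>u\<close> (\<open>attractor_not_COSC\<close>).

  The exceptional parameters lie in countably many sets, each cut out by a vanishing coordinate or by a
  nontrivial monomial relation, and each is a null set because all but one of the coordinates
  determine the remaining one up to finitely many values (\<open>inadmissible_null_set\<close>).
\<close>

section \<open>Gap lengths of compact sets\<close>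

text \<open>
  The gaps of a compact set are the bounded components of its complement, given here by their end
  points, which belong to the set.
\<close>

definition gap_lengths :: "real set \<Rightarrow> real set" where
  "gap_lengths K = {b - a |a b. a \<in> K \<and> b \<in> K \<and> a < b \<and> K \<inter> {a<..<b} = {}}"

text \<open>
  The end points come in no particular order, so that orientation-reversing maps need no separate
  treatment later on.
\<close>

lemma gap_lengthsI:
  assumes "s \<in> K" "t \<in> K" "s \<noteq> t" "\<And>y. y \<in> K \<Longrightarrow> \<not> (min s t < y \<and> y < max s t)"
  shows "\<bar>s - t\<bar> \<in> gap_lengths K"
proof -
  have "\<bar>s - t\<bar> = max s t - min s t" "min s t < max s t" "min s t \<in> K" "max s t \<in> K"
    using assms(1-3) by (auto simp: max_def min_def)
  moreover have "K \<inter> {min s t<..<max s t} = {}" using assms(4) by auto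
  ultimately show ?thesis unfolding gap_lengths_def by blast
qed

lemma between_affine_images:
  fixes r :: real
  assumes "a < b" "r \<noteq> 0"
    "min (r * a + c) (r * b + c) < y" "y < max (r * a + c) (r * b + c)"
  obtains s where "a < s" "s < b" "y = r * s + c"
proof
  show "y = r * ((y - c) / r) + c" using assms(2) by simp
  show "a < (y - c) / r" "(y - c) / r < b"
    using assms by (cases "r > 0"; auto simp: field_simps min_def max_def split: if_splits)+
qed

lemma gap_lengths_affine:
  fixes r c :: real
  assumes "r \<noteq> 0"
  shows "gap_lengths ((\<lambda>t. r * t + c) ` K) = (*) \<bar>r\<bar> ` gap_lengths K"
proof -
  have sub: "\<bar>r\<bar> * g \<in> gap_lengths ((\<lambda>t. r * t + c) ` K)"
    if r: "r \<noteq> 0" and g: "g \<in> gap_lengths K" for r c g :: real and K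
  proof -
    obtain a b where ab: "a \<in> K" "b \<in> K" "a < b" "K \<inter> {a<..<b} = {}" "g = b - a"
      using g unfolding gap_lengths_def by blast
    have "\<bar>(r * a + c) - (r * b + c)\<bar> \<in> gap_lengths ((\<lambda>t. r * t + c) ` K)"
    proof (rule gap_lengthsI)
      fix y assume y: "y \<in> (\<lambda>t. r * t + c) ` K"
      show "\<not> (min (r * a + c) (r * b + c) < y \<and> y < max (r * a + c) (r * b + c))"
      proof
        assume "min (r * a + c) (r * b + c) < y \<and> y < max (r * a + c) (r * b + c)"
        then obtain s where "a < s" "s < b" "y = r * s + c"
          using between_affine_images[OF ab(3) r] by blast
        thus False using y r ab(4) by auto
      qed
    qed (use ab r in auto)
    also have "\<bar>(r * a + c) - (r * b + c)\<bar> = \<bar>r\<bar> * g"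
      using ab(3,5) by (simp add: abs_mult flip: right_diff_distrib)
    finally show ?thesis .
  qed
  \<comment> \<open>The other inclusion is the same statement for the inverse map.\<close>
  show ?thesis
  proof (intro equalityI subsetI)
    fix g assume g: "g \<in> gap_lengths ((\<lambda>t. r * t + c) ` K)"
    have K: "(\<lambda>t. inverse r * t + (- c / r)) ` (\<lambda>t. r * t + c) ` K = K"
      using assms by (auto simp: image_image field_simps)
    have "\<bar>inverse r\<bar> * g \<in> gap_lengths K"
      using sub[OF _ g, of "inverse r" "- c / r"] assms unfolding K by simp
    hence "\<bar>r\<bar> * (\<bar>inverse r\<bar> * g) \<in> (*) \<bar>r\<bar> ` gap_lengths K" by (rule imageI)
    thus "g \<in> (*) \<bar>r\<bar> ` gap_lengths K" using assms by (simp flip: abs_mult mult.assoc)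
  qed (use sub[OF assms] in auto)
qed

text \<open>
  When pieces lie in pairwise separated intervals and contain the end points of these intervals, a
  gap of the union that is not a gap of one piece has to run from the right end of an interval to
  the left end of the next one.
\<close>

lemma gap_lengths_separated_union:
  fixes A :: "nat \<Rightarrow> real set"
  assumes A: "\<And>k. k \<in> {1..d} \<Longrightarrow> A k \<subseteq> {p k..q k} \<and> p k \<in> A k \<and> q k \<in> A k"
    and sep: "\<And>k. k \<in> {1..d - 1} \<Longrightarrow> q k < p (Suc k)"
  shows "gap_lengths (\<Union>k\<in>{1..d}. A k) =
    {p (Suc k) - q k |k. k \<in> {1..d - 1}} \<union> (\<Union>k\<in>{1..d}. gap_lengths (A k))"
proof -
  have pq: "p k \<le> q k" if "k \<in> {1..d}" for k using A[OF that] by auto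
  have mono_q: "q j \<le> q k" if "1 \<le> j" "j \<le> k" "k \<le> d" for j k
    using that(2,3)
  proof (induction k rule: dec_induct)
    case (step k)
    then show ?case using sep[of k] pq[of "Suc k"] that(1) by fastforce
  qed simp
  have lt: "q j < p k" if "1 \<le> j" "j < k" "k \<le> d" for j k
    using mono_q[of j "k - 1"] sep[of "k - 1"] that by fastforce
  have mono_p: "p j \<le> p k" if "1 \<le> j" "j \<le> k" "k \<le> d" for j k
    using lt[of j k] pq[of j] that by (cases "j = k") auto
  show ?thesis (is "gap_lengths ?U = ?R")
  proof (intro equalityI subsetI)
    fix g assume "g \<in> gap_lengths ?U"
    then obtain a b where ab: "a \<in> ?U" "b \<in> ?U" "a < b" "?U \<inter> {a<..<b} = {}" "g = b - a"
      unfolding gap_lengths_def by blast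
    then obtain j k where jk: "j \<in> {1..d}" "a \<in> A j" "k \<in> {1..d}" "b \<in> A k" by auto
    have aj: "p j \<le> a" "a \<le> q j" and bk: "p k \<le> b" "b \<le> q k"
      using A[OF jk(1)] A[OF jk(3)] jk(2,4) by auto
    consider "j < k" | "j = k" | "k < j" by linarith
    thus "g \<in> ?R"
    proof cases
      case 1
      have "q j \<in> ?U" using A[OF jk(1)] jk(1) by blast
      moreover have "q j < p k" using lt 1 jk by auto
      ultimately have a: "a = q j" using ab(4) aj bk by force
      have s: "Suc j \<in> {1..d}" "j \<in> {1..d - 1}" using 1 jk by auto
      hence "p (Suc j) \<in> ?U" using A by blast
      moreover have "p (Suc j) \<le> p k" using mono_p 1 jk by auto
      ultimately have "b = p (Suc j)" using ab(4) sep[OF s(2)] a bk by force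
      thus ?thesis using a ab(5) s(2) by blast
    next
      case 2
      hence "g \<in> gap_lengths (A j)" using ab jk unfolding gap_lengths_def by blast
      thus ?thesis using jk by blast
    next
      case 3
      hence "q k < p j" using lt jk by auto
      thus ?thesis using aj bk ab(3) by linarith
    qed
  next
    fix g assume "g \<in> ?R"
    then consider k where "k \<in> {1..d - 1}" "g = p (Suc k) - q k"
      | k where "k \<in> {1..d}" "g \<in> gap_lengths (A k)" by blast
    thus "g \<in> gap_lengths ?U"
    proof cases
      case 1
      have s: "Suc k \<in> {1..d}" "k \<in> {1..d}" using 1 by auto
      have "y \<notin> {q k<..<p (Suc k)}" if yU: "y \<in> ?U" for y
      proof -
        obtain j where j: "j \<in> {1..d}" "y \<in> A j" using yU by blast
        hence "p j \<le> y" "y \<le> q j" using A[OF j(1)] by auto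
        thus ?thesis using mono_q[of j k] mono_p[of "Suc k" j] j s by (cases "j \<le> k") auto
      qed
      moreover have "q k \<in> ?U" "p (Suc k) \<in> ?U" using A s by blast+
      ultimately show ?thesis using sep[OF 1(1)] 1(2) unfolding gap_lengths_def by blast
    next
      case 2
      then obtain a b where ab: "a \<in> A k" "b \<in> A k" "a < b" "A k \<inter> {a<..<b} = {}" "g = b - a"
        unfolding gap_lengths_def by blast
      have abk: "p k \<le> a" "b \<le> q k" using A[OF 2(1)] ab by auto
      have "y \<notin> {a<..<b}" if yU: "y \<in> ?U" for y
      proof -
        obtain j where j: "j \<in> {1..d}" "y \<in> A j" using yU by blast
        hence y: "p j \<le> y" "y \<le> q j" using A[OF j(1)] by auto
        consider "j < k" | "j = k" | "k < j" by linarith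
        thus ?thesis
        proof cases
          case 1 thus ?thesis using lt[of j k] j 2 y abk by auto
        next
          case 2 thus ?thesis using ab j by auto
        next
          case 3 thus ?thesis using lt[of k j] j 2 y abk by auto
        qed
      qed
      moreover have "a \<in> ?U" "b \<in> ?U" using ab 2 by blast+
      ultimately show ?thesis using ab unfolding gap_lengths_def by blast
    qed
  qed
qed

text \<open>
  The maximal distance \<open>m\<close> of a point of some \<open>K v\<close> from the corresponding \<open>C v\<close> is attained; writing
  the maximizing point as the image of another point of the family shows \<open>m \<le> r * m\<close> with \<open>r < 1\<close>.
  The lemma is used in both directions: with attractors as \<open>K\<close> it bounds them from above by invariant
  sets, and with attractors as \<open>C\<close> it shows that they contain every family of compact sets covered by
  its own images.
\<close>

lemma contracting_family_subset:
  fixes K C :: "'i \<Rightarrow> 'a::heine_borel set"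
  assumes fin: "finite V"
    and K: "\<And>v. v \<in> V \<Longrightarrow> compact (K v)"
    and C: "\<And>v. v \<in> V \<Longrightarrow> closed (C v) \<and> C v \<noteq> {}"
    and step: "\<And>v t. v \<in> V \<Longrightarrow> t \<in> K v \<Longrightarrow>
      \<exists>w\<in>V. \<exists>s\<in>K w. \<exists>f r. r < 1 \<and> (\<forall>y z. dist (f y) (f z) \<le> r * dist y z) \<and> t = f s \<and> f ` C w \<subseteq> C v"
    and w: "w \<in> V"
  shows "K w \<subseteq> C w"
proof
  fix t assume t: "t \<in> K w"
  define D where "D = (\<Union>v\<in>V. (\<lambda>t. infdist t (C v)) ` K v)"
  have "compact D" unfolding D_def
    by (intro compact_UN fin compact_continuous_image K) (auto intro!: continuous_intros)
  moreover have "D \<noteq> {}" using t w unfolding D_def by auto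
  ultimately obtain m where m: "m \<in> D" "\<And>y. y \<in> D \<Longrightarrow> y \<le> m" by (meson compact_attains_sup)
  obtain v t' where v: "v \<in> V" "t' \<in> K v" "m = infdist t' (C v)" using m(1) unfolding D_def by auto
  obtain v' s f r where s: "v' \<in> V" "s \<in> K v'" "r < 1"
    "\<And>y z. dist (f y) (f z) \<le> r * dist y z" "t' = f s" "f ` C v' \<subseteq> C v"
    using step[OF v(1,2)] by blast
  obtain z where z: "z \<in> C v'" "infdist s (C v') = dist s z"
    using infdist_attains_inf C[OF s(1)] by blast
  have "dist s z \<le> m" using m(2)[of "infdist s (C v')"] s(1,2) unfolding D_def z(2)[symmetric] by blast
  moreover have "m \<le> dist (f s) (f z)"
    unfolding v(3) s(5) using z(1) s(6) by (intro infdist_le) auto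
  moreover have "dist (f s) (f z) \<le> r * dist s z" by (rule s(4))
  moreover have "0 \<le> dist s z" by simp
  ultimately have "m \<le> 0" using s(3)
    by (smt (verit) mult_left_le_one_le mult_less_cancel_right2 mult_nonneg_nonneg mult_nonpos_nonneg)
  moreover have "infdist t (C w) \<le> m" using t w m(2) unfolding D_def by blast
  ultimately have "infdist t (C w) = 0" using infdist_nonneg[of t "C w"] by linarith
  thus "t \<in> C w" using in_closed_iff_infdist_zero C[OF w] by blast
qed

section \<open>Gaps of attractors under the convex open set condition\<close>

definition contraction_ratio :: "(real \<Rightarrow> real) \<Rightarrow> real" where
  "contraction_ratio f = \<bar>f 1 - f 0\<bar>"

lemma contracting_similarityE:
  assumes "contracting_similarity f"
  obtains r c where "f = (\<lambda>t. r * t + c)" "r \<noteq> 0" "\<bar>r\<bar> < 1" "contraction_ratio f = \<bar>r\<bar>"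
  using assms unfolding contracting_similarity_def contraction_ratio_def
  by (auto simp: abs_less_iff)

lemma contracting_similarity_continuous:
  assumes "contracting_similarity f"
  shows "continuous_on S f"
  using assms by (auto elim!: contracting_similarityE intro!: continuous_intros)

lemma contraction_ratio_less_1:
  assumes "contracting_similarity f"
  shows "contraction_ratio f < 1"
  using assms by (auto elim!: contracting_similarityE)

lemma standard_ifsE:
  assumes "standard_ifs I" "f \<in> I"
  obtains r c where "f = (\<lambda>t. r * t + c)" "r \<noteq> 0" "\<bar>r\<bar> < 1" "contraction_ratio f = \<bar>r\<bar>"
  using assms contracting_similarityE unfolding standard_ifs_def by metis

lemma attractor_subset_closure:
  assumes I: "standard_ifs I" "ifs_attractor I K" and U: "U \<noteq> {}" "(\<Union>f\<in>I. f ` U) \<subseteq> U"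
  shows "K \<subseteq> closure U"
proof (rule contracting_family_subset[where V = "{()}" and K = "\<lambda>_. K" and C = "\<lambda>_. closure U"])
  fix v :: unit and t assume "t \<in> K"
  then obtain f s where f: "f \<in> I" "t = f s" "s \<in> K" using I(2) unfolding ifs_attractor_def by blast
  obtain r c where r: "f = (\<lambda>t. r * t + c)" "r \<noteq> 0" "\<bar>r\<bar> < 1" "contraction_ratio f = \<bar>r\<bar>"
      by (rule standard_ifsE[OF I(1) f(1)])
  have "continuous_on (closure U) f" unfolding r(1) by (intro continuous_intros)
  moreover have "f ` U \<subseteq> closure U" using U(2) f(1) closure_subset by blast
  ultimately have "f ` closure U \<subseteq> closure U" by (intro image_closure_subset) auto
  moreover have "dist (f y) (f z) \<le> \<bar>r\<bar> * dist y z" for y z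
    by (simp add: r(1) dist_real_def flip: abs_mult right_diff_distrib)
  ultimately show "\<exists>w\<in>{()}. \<exists>s\<in>K. \<exists>f r. r < 1 \<and> (\<forall>y z. dist (f y) (f z) \<le> r * dist y z) \<and>
      t = f s \<and> f ` closure U \<subseteq> closure U"
    using f r(3) by blast
qed (use I(2) U(1) in \<open>auto simp: ifs_attractor_def\<close>)

text \<open>
  Let \<open>U\<close> be the open set of the COSC. A convex open set is the interior of its closure, and the
  closure contains the attractor, so \<open>U\<close> contains the open interval between any two points of the
  attractor. The images of \<open>U\<close> being open and disjoint, an image of that interval cannot meet the
  closure of another image of \<open>U\<close>. This is where convexity enters.
\<close>

lemma COSC_open_pieces_disjoint:
  assumes I: "standard_ifs I" "COSC I" "ifs_attractor I K"
    and f: "f \<in> I" "f' \<in> I" "f \<noteq> f'" and ab: "a \<in> K" "b \<in> K" and y: "a < y" "y < b"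
  shows "f y \<notin> f' ` K"
proof
  assume mem: "f y \<in> f' ` K"
  obtain U where U: "U \<noteq> {}" "convex U" "open U" "(\<Union>f\<in>I. f ` U) \<subseteq> U"
    "disjoint_family_on (\<lambda>f. f ` U) I" using I(2) unfolding COSC_def by blast
  have KU: "K \<subseteq> closure U" by (rule attractor_subset_closure[OF I(1,3) U(1,4)])
  have "{a..b} \<subseteq> closure U"
    using convex_contains_segment[of "closure U"] U(2) convex_closure ab KU y
    by (metis closed_segment_eq_real_ivl less_eq_real_def less_trans subsetD)
  hence "{a<..<b} \<subseteq> interior (closure U)"
    by (intro interior_maximal) (auto simp: subset_iff)
  hence "{a<..<b} \<subseteq> U" using convex_interior_closure[OF U(2)] U(3) interior_open by metis
  hence yU: "f y \<in> f ` U" using y by auto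
  obtain r c where r: "f = (\<lambda>t. r * t + c)" "r \<noteq> 0" "\<bar>r\<bar> < 1" "contraction_ratio f = \<bar>r\<bar>"
      by (rule standard_ifsE[OF I(1) f(1)])
  have "open ((\<lambda>x. c + r *\<^sub>R x) ` U)" by (rule open_affinity[OF U(3) r(2)])
  moreover have "(\<lambda>x. c + r *\<^sub>R x) = f" by (auto simp: r(1))
  ultimately have o: "open (f ` U)" by metis
  have cont: "continuous_on (closure U) f'"
    using I(1) f(2) unfolding standard_ifs_def by (intro contracting_similarity_continuous) auto
  have "f' ` closure U \<subseteq> closure (f' ` U)"
    by (rule image_closure_subset[OF cont]) (auto simp: closure_subset)
  hence "f y \<in> closure (f' ` U)" using mem KU by blast
  moreover have "f ` U \<inter> f' ` U = {}" using U(5) f unfolding disjoint_family_on_def by simp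
  hence "f ` U \<inter> closure (f' ` U) = {}" by (simp add: open_Int_closure_eq_empty[OF o])
  ultimately show False using yU by auto
qed

text \<open>
  A map of the system sends a gap to an interval that no other piece of the attractor can meet.
\<close>

lemma COSC_scaled_gaps:
  assumes I: "standard_ifs I" "COSC I" "ifs_attractor I K" and f: "f \<in> I"
    and g: "g \<in> gap_lengths K"
  shows "contraction_ratio f * g \<in> gap_lengths K"
proof -
  obtain r c where r: "f = (\<lambda>t. r * t + c)" "r \<noteq> 0" "\<bar>r\<bar> < 1" "contraction_ratio f = \<bar>r\<bar>"
      by (rule standard_ifsE[OF I(1) f])
  obtain a b where ab: "a \<in> K" "b \<in> K" "a < b" "K \<inter> {a<..<b} = {}" "g = b - a"
    using g unfolding gap_lengths_def by blast
  have K: "K = (\<Union>f\<in>I. f ` K)" using I(3) unfolding ifs_attractor_def by simp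
  have "\<bar>f a - f b\<bar> \<in> gap_lengths K"
  proof (rule gap_lengthsI)
    show "f a \<in> K" "f b \<in> K" using K f ab by blast+
    show "f a \<noteq> f b" using ab(3) r by auto
    fix y assume y: "y \<in> K"
    show "\<not> (min (f a) (f b) < y \<and> y < max (f a) (f b))"
    proof
      assume "min (f a) (f b) < y \<and> y < max (f a) (f b)"
      then obtain s where s: "a < s" "s < b" "y = f s"
        using between_affine_images[OF ab(3) r(2)] unfolding r(1) by blast
      obtain f' t where f': "f' \<in> I" "t \<in> K" "y = f' t" using y K by blast
      have "f = f'" using COSC_open_pieces_disjoint[OF I f f'(1) _ ab(1,2) s(1,2)] s(3) f' by blast
      hence "s = t" using s(3) f'(3) r by auto
      thus False using f'(2) s ab(4) by auto
    qed
  qed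
  also have "\<bar>f a - f b\<bar> = contraction_ratio f * g"
    using ab(3,5) by (simp add: r(1) r(4)[unfolded r(1)] abs_mult flip: right_diff_distrib)
  finally show ?thesis .
qed

text \<open>
  A gap with both end points in one piece is a scaled gap. Otherwise its left end point has to be the
  maximum of the piece \<open>f ` K\<close> containing it, because the right end point, lying in another piece,
  cannot be strictly between two points of \<open>f ` K\<close>. The left end point determines the gap, so there
  is at most one gap of the second kind for each map, whence the finite set \<open>B\<close>.
\<close>

lemma COSC_gaps_decompose:
  assumes I: "standard_ifs I" "COSC I" "ifs_attractor I K"
  obtains B where "finite B"
    "gap_lengths K \<subseteq> B \<union> (\<Union>f\<in>I. (*) (contraction_ratio f) ` gap_lengths K)"
proof
  \<comment> \<open>\<open>succ a\<close> is the right end point of the gap that starts at \<open>a\<close>, if there is one.\<close>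
  define succ where "succ a = (THE b. b \<in> K \<and> a < b \<and> K \<inter> {a<..<b} = {})" for a
  define B where "B = (\<lambda>a. succ a - a) ` (\<lambda>f. Sup (f ` K)) ` I"
  have finI: "finite I" using I(1) unfolding standard_ifs_def by simp
  thus "finite B" unfolding B_def by simp
  have K: "K = (\<Union>f\<in>I. f ` K)" and cK: "compact K" "K \<noteq> {}"
    using I(3) unfolding ifs_attractor_def by auto
  show "gap_lengths K \<subseteq> B \<union> (\<Union>f\<in>I. (*) (contraction_ratio f) ` gap_lengths K)"
  proof
    fix g assume "g \<in> gap_lengths K"
    then obtain a b where ab: "a \<in> K" "b \<in> K" "a < b" "K \<inter> {a<..<b} = {}" "g = b - a"
      unfolding gap_lengths_def by blast
    obtain f where f: "f \<in> I" "a \<in> f ` K" using ab(1) K by blast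
    obtain r c where r: "f = (\<lambda>t. r * t + c)" "r \<noteq> 0" "\<bar>r\<bar> < 1" "contraction_ratio f = \<bar>r\<bar>"
      by (rule standard_ifsE[OF I(1) f(1)])
    have fK: "f ` K \<subseteq> K" using K f(1) by blast
    show "g \<in> B \<union> (\<Union>f\<in>I. (*) (contraction_ratio f) ` gap_lengths K)"
    proof (cases "b \<in> f ` K")
      case True
      hence "g \<in> gap_lengths (f ` K)" using ab f(2) fK unfolding gap_lengths_def by blast
      hence "g \<in> (*) (contraction_ratio f) ` gap_lengths K"
        unfolding r(4) unfolding r(1) gap_lengths_affine[OF r(2)] .
      thus ?thesis using f(1) by blast
    next
      case False
      obtain f' where f': "f' \<in> I" "b \<in> f' ` K" using ab(2) K by blast
      have "f \<noteq> f'" using f' False by blast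
      have "compact (f ` K)" unfolding r(1)
        by (intro compact_continuous_image cK continuous_intros)
      then obtain M where M: "M \<in> f ` K" "\<And>y. y \<in> f ` K \<Longrightarrow> y \<le> M"
        using f(2) compact_attains_sup by (metis empty_iff)
      have "M = a"
      proof (rule ccontr)
        assume "M \<noteq> a"
        hence "a < M" using M(2)[OF f(2)] by simp
        moreover have "M \<in> K" "M \<noteq> b" using M(1) fK False by auto
        ultimately have bM: "b < M" using ab(4) by (meson disjoint_iff greaterThanLessThan_iff linorder_neqE)
        obtain s t where st: "a = f s" "M = f t" "s \<in> K" "t \<in> K" using f(2) M(1) by blast
        define s' t' where "s' = min s t" and "t' = max s t"
        have st': "s' \<in> K" "t' \<in> K" "s' < t'" "min (r * s' + c) (r * t' + c) < b" "b < max (r * s' + c) (r * t' + c)"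
          using st \<open>M \<noteq> a\<close> bM ab(3) unfolding s'_def t'_def r(1) by (auto simp: min_def max_def)
        obtain y where y: "s' < y" "y < t'" "b = f y"
          using between_affine_images[OF st'(3) r(2) st'(4,5)] unfolding r(1) by blast
        show False
          using COSC_open_pieces_disjoint[OF I f(1) f'(1) \<open>f \<noteq> f'\<close> st'(1,2) y(1,2)] y(3) f'(2) by simp
      qed
      hence "Sup (f ` K) = a" using M by (intro cSup_eq_maximum) auto
      moreover have "succ a = b" unfolding succ_def
      proof (rule the_equality)
        fix b' assume "b' \<in> K \<and> a < b' \<and> K \<inter> {a<..<b'} = {}"
        thus "b' = b" using ab by (meson disjoint_iff greaterThanLessThan_iff linorder_neqE)
      qed (use ab in auto)
      ultimately show ?thesis using f(1) ab(5) unfolding B_def by blast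
    qed
  qed
qed


section \<open>Nonnegative matrices of spectral radius below one\<close>

text \<open>
  The negative part \<open>y\<close> of \<open>v\<close> satisfies \<open>y i + w i \<le> (A y) i\<close> wherever \<open>y i > 0\<close>. If \<open>y\<close> did not
  vanish, this would give \<open>(1 + \<epsilon>) y \<le> A y\<close> for some \<open>\<epsilon> > 0\<close>, hence \<open>(1 + \<epsilon>)\<^sup>k y \<le> A\<^sup>k y\<close> for all
  \<open>k\<close>, whereas the powers of a matrix of spectral radius below one are bounded. So \<open>v \<ge> 0\<close>, and then
  the equation for \<open>v\<close> gives strict positivity.
\<close>

lemma pos_solution_of_nonneg_system:
  fixes A :: "real mat"
  assumes A: "A \<in> carrier_mat n n" and nonneg: "\<And>i j. i < n \<Longrightarrow> j < n \<Longrightarrow> A $$ (i, j) \<ge> 0"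
    and sr: "spectral_radius (map_mat complex_of_real A) < 1"
    and v: "\<And>i. i < n \<Longrightarrow> v i = (\<Sum>j<n. A $$ (i, j) * v j) + w i" and w: "\<And>i. i < n \<Longrightarrow> w i > 0"
    and i: "i < n"
  shows "v i > 0"
proof -
  define y where "y i = max (- v i) 0" for i
  have y0: "y i \<ge> 0" for i by (simp add: y_def)
  have grow: "y i = 0 \<or> y i + w i \<le> (\<Sum>j<n. A $$ (i, j) * y j)" if i: "i < n" for i
  proof (cases "v i < 0")
    case True
    have "- (\<Sum>j<n. A $$ (i, j) * v j) \<le> (\<Sum>j<n. A $$ (i, j) * y j)"
      unfolding sum_negf[symmetric]
    proof (intro sum_mono)
      fix j assume "j \<in> {..<n}"
      hence "A $$ (i, j) * (- v j) \<le> A $$ (i, j) * y j"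
        using nonneg[OF i] by (intro mult_left_mono) (auto simp: y_def)
      thus "- (A $$ (i, j) * v j) \<le> A $$ (i, j) * y j" by simp
    qed
    thus ?thesis using v[OF i] True by (simp add: y_def)
  qed (simp add: y_def)
  have "v i \<ge> 0" if i: "i < n" for i
  proof (rule ccontr)
    assume "\<not> v i \<ge> 0"
    hence yi: "y i > 0" by (simp add: y_def)
    define Y where "Y = (\<Sum>j<n. y j)"
    have yY: "y j \<le> Y" if "j < n" for j
      unfolding Y_def using that y0 by (intro member_le_sum) auto
    have Y: "Y > 0" using yi yY[OF i] by simp
    \<comment> \<open>Any \<open>\<epsilon>\<close> with \<open>\<epsilon> * y j \<le> w j\<close> for all \<open>j\<close> serves.\<close>
    define \<epsilon> where "\<epsilon> = Min (w ` {..<n}) / Y"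
    have "Min (w ` {..<n}) > 0" using w i by (subst Min_gr_iff) auto
    hence \<epsilon>: "\<epsilon> > 0" using Y by (simp add: \<epsilon>_def)
    have grow': "(1 + \<epsilon>) * y j \<le> (\<Sum>k<n. A $$ (j, k) * y k)" if j: "j < n" for j
    proof -
      have "\<epsilon> * y j \<le> \<epsilon> * Y" using \<epsilon> yY[OF j] by simp
      also have "\<dots> = Min (w ` {..<n})" using Y by (simp add: \<epsilon>_def)
      also have "\<dots> \<le> w j" using j by simp
      finally have "(1 + \<epsilon>) * y j \<le> y j + w j" by (simp add: algebra_simps)
      moreover have "0 \<le> (\<Sum>k<n. A $$ (j, k) * y k)"
        using nonneg[OF j] y0 by (intro sum_nonneg) simp
      ultimately show ?thesis using grow[OF j] by (cases "y j = 0") auto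
    qed
    have Ak: "A ^\<^sub>m k \<in> carrier_mat n n" for k using A by (rule pow_carrier_mat)
    have entry: "(A ^\<^sub>m Suc k) $$ (a, b) = (\<Sum>j<n. (A ^\<^sub>m k) $$ (a, j) * A $$ (j, b))"
      if "a < n" "b < n" for a b k
      using that A Ak[of k] by (auto simp: scalar_prod_def lessThan_atLeast0 intro!: sum.cong)
    have pow_nonneg: "a < n \<Longrightarrow> b < n \<Longrightarrow> (A ^\<^sub>m k) $$ (a, b) \<ge> 0" for a b k
    proof (induction k arbitrary: a b)
      case 0
      then show ?case using A by (cases "a = b") auto
    next
      case (Suc k)
      show ?case unfolding entry[OF Suc.prems] using Suc nonneg by (intro sum_nonneg) simp
    qed
    have pow_grow: "(1 + \<epsilon>) ^ k * y i \<le> (\<Sum>j<n. (A ^\<^sub>m k) $$ (i, j) * y j)" for k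
    proof (induction k)
      case 0
      have "(\<Sum>j<n. (A ^\<^sub>m 0) $$ (i, j) * y j) = (\<Sum>j<n. if i = j then y j else 0)"
        using A i by (intro sum.cong) auto
      then show ?case using i by simp
    next
      case (Suc k)
      have "(1 + \<epsilon>) ^ Suc k * y i = (1 + \<epsilon>) * ((1 + \<epsilon>) ^ k * y i)" by simp
      also have "\<dots> \<le> (1 + \<epsilon>) * (\<Sum>j<n. (A ^\<^sub>m k) $$ (i, j) * y j)"
        using Suc \<epsilon> by (intro mult_left_mono) auto
      also have "\<dots> = (\<Sum>j<n. (A ^\<^sub>m k) $$ (i, j) * ((1 + \<epsilon>) * y j))"
        by (simp add: sum_distrib_left mult_ac)
      also have "\<dots> \<le> (\<Sum>j<n. (A ^\<^sub>m k) $$ (i, j) * (\<Sum>l<n. A $$ (j, l) * y l))"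
        using grow' pow_nonneg[OF i] by (intro sum_mono mult_left_mono) auto
      also have "\<dots> = (\<Sum>j<n. \<Sum>l<n. (A ^\<^sub>m k) $$ (i, j) * A $$ (j, l) * y l)"
        by (simp add: sum_distrib_left mult.assoc)
      also have "\<dots> = (\<Sum>l<n. \<Sum>j<n. (A ^\<^sub>m k) $$ (i, j) * A $$ (j, l) * y l)"
        by (rule sum.swap)
      also have "\<dots> = (\<Sum>l<n. (A ^\<^sub>m Suc k) $$ (i, l) * y l)"
        using entry[OF i] by (intro sum.cong) (simp_all add: sum_distrib_right)
      finally show ?case .
    qed
    have "map_mat complex_of_real A \<in> carrier_mat n n" using A by simp
    then obtain c where c: "\<And>k. norm_bound (map_mat complex_of_real A ^\<^sub>m k) c"
      using spectral_radius_jnf_norm_bound_less_1_upper_triangular[OF _ sr] by blast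
    have "(A ^\<^sub>m k) $$ (i, j) \<le> c" if "j < n" for k j
    proof -
      have "map_mat complex_of_real (A ^\<^sub>m k) = map_mat complex_of_real A ^\<^sub>m k"
        by (rule of_real_hom.mat_hom_pow[OF A])
      hence "norm_bound (map_mat complex_of_real (A ^\<^sub>m k)) c" using c by simp
      hence "norm (complex_of_real ((A ^\<^sub>m k) $$ (i, j))) \<le> c"
        unfolding norm_bound_def using i that A by (auto split: if_splits)
      thus ?thesis by simp
    qed
    hence "(\<Sum>j<n. (A ^\<^sub>m k) $$ (i, j) * y j) \<le> (\<Sum>j<n. c * y j)" for k
      using y0 by (intro sum_mono mult_right_mono) auto
    hence bound: "(1 + \<epsilon>) ^ k \<le> (\<Sum>j<n. c * y j) / y i" for k
      using pow_grow[of k] yi by (simp add: pos_le_divide_eq) (meson order_trans)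
    obtain k where "(\<Sum>j<n. c * y j) / y i < (1 + \<epsilon>) ^ k"
      using real_arch_pow[of "1 + \<epsilon>"] \<epsilon> by auto
    thus False using bound[of k] by linarith
  qed
  hence "(\<Sum>j<n. A $$ (i, j) * v j) \<ge> 0" using nonneg[OF i] by (intro sum_nonneg) simp
  thus ?thesis using v[OF i] w[OF i] by linarith
qed

lemma mat_inverse_one_minus:
  fixes A :: "real mat"
  assumes A: "A \<in> carrier_mat n n" and sr: "spectral_radius (map_mat complex_of_real A) < 1"
    and n: "n > 0"
  obtains B where "mat_inverse (1\<^sub>m n - A) = Some B" "(1\<^sub>m n - A) * B = 1\<^sub>m n" "B \<in> carrier_mat n n"
proof -
  have A': "1\<^sub>m n - A \<in> carrier_mat n n" using A by auto
  have "Determinant.det (1\<^sub>m n - A) \<noteq> 0"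
  proof
    assume "Determinant.det (1\<^sub>m n - A) = 0"
    then obtain v where v: "v \<in> carrier_vec n" "v \<noteq> 0\<^sub>v n" "(1\<^sub>m n - A) *\<^sub>v v = 0\<^sub>v n"
      using det_0_iff_vec_prod_zero_field[OF A'] by blast
    have Av: "A *\<^sub>v v = v"
    proof -
      have "v - A *\<^sub>v v = 0\<^sub>v n"
        using v A by (subst (asm) minus_mult_distrib_mat_vec[of _ n n]) auto
      hence *: "vec_index (v - A *\<^sub>v v) i = 0" if "i < n" for i using that by simp
      show ?thesis
      proof (rule eq_vecI)
        fix i assume i: "i < dim_vec v"
        show "vec_index (A *\<^sub>v v) i = vec_index v i" using *[of i] i v(1) A by simp
      qed (use v(1) A in auto)
    qed
    let ?v = "map_vec complex_of_real v"
    have "map_mat complex_of_real A *\<^sub>v ?v = 1 \<cdot>\<^sub>v ?v"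
      using of_real_hom.mult_mat_vec_hom[OF A v(1), where ?'a = complex] Av by simp
    moreover have "?v \<noteq> 0\<^sub>v n"
    proof
      assume *: "?v = 0\<^sub>v n"
      have "v = 0\<^sub>v n"
      proof (rule eq_vecI)
        fix i assume i: "i < dim_vec (0\<^sub>v n :: real vec)"
        have "vec_index ?v i = 0" using i by (simp add: *)
        thus "vec_index v i = vec_index (0\<^sub>v n) i" using i v(1) by simp
      qed (use v(1) in auto)
      thus False using v(2) by simp
    qed
    ultimately have "eigenvalue (map_mat complex_of_real A) 1"
      unfolding eigenvalue_def eigenvector_def using v(1) A by (intro exI[of _ ?v]) auto
    hence "(1::real) \<in> norm ` spectrum (map_mat complex_of_real A)"
      unfolding spectrum_def by force
    hence "1 \<le> spectral_radius (map_mat complex_of_real A)"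
      using spectral_radius_mem_max(2)[of "map_mat complex_of_real A" n 1] A n by simp
    thus False using sr by simp
  qed
  hence unit: "1\<^sub>m n - A \<in> Units (ring_mat TYPE(real) n ())" by (rule det_non_zero_imp_unit[OF A'])
  hence "mat_inverse (1\<^sub>m n - A) \<noteq> None" using mat_inverse(1)[OF A', of "()"] by blast
  then obtain B where B: "mat_inverse (1\<^sub>m n - A) = Some B" by blast
  show ?thesis using that[OF B] mat_inverse(2)[OF A' B] by blast
qed


section \<open>The intervals of the graph-directed system\<close>

locale interval_system = fin_digraph G
  for G :: "(nat, 'e) pre_digraph" +
  fixes N :: nat and e :: "nat \<Rightarrow> nat \<Rightarrow> 'e" and x :: "coord \<Rightarrow> real"
    and b :: "nat \<Rightarrow> real" and F :: "nat \<Rightarrow> real set"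
  assumes verts: "verts G = {1..N}"
    and out_degree: "\<And>i. i \<in> verts G \<Longrightarrow> out_degree G i \<ge> 2"
    and ordering: "edge_ordering G e"
    and param: "x \<in> P1 G e"
    and attractor: "gd_attractor G (gd_map G e x b) F"
begin

abbreviation l :: "nat \<Rightarrow> real" where "l \<equiv> seg_len G e x"

definition arc_coord :: "'e \<Rightarrow> coord" where
  "arc_coord a = Ratio (tail G a) (the_inv_into {1..out_degree G (tail G a)} (e (tail G a)) a)"

text \<open>
  The image of the hull \<open>[b j, b j + l j]\<close> under the map of the \<open>k\<close>-th edge leaving \<open>i\<close>, where \<open>j\<close> is
  the head of that edge, is the interval from \<open>piece_left i k\<close> to \<open>piece_right i k\<close>.
\<close>

definition piece_left :: "nat \<Rightarrow> nat \<Rightarrow> real" where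
  "piece_left i k = left_pt G e x b i k"

definition piece_right :: "nat \<Rightarrow> nat \<Rightarrow> real" where
  "piece_right i k = left_pt G e x b i k + \<bar>x (Ratio i k)\<bar> * l (head G (e i k))"

lemma ratio:
  assumes "i \<in> verts G" "k \<in> {1..out_degree G i}"
  shows "x (Ratio i k) \<noteq> 0" "\<bar>x (Ratio i k)\<bar> < 1"
  using param assms unfolding P1_def P0_def by (auto simp: abs_less_iff)

lemma gap:
  assumes "i \<in> verts G" "k \<in> {1..out_degree G i - 1}"
  shows "x (Gap i k) > 0"
  using param assms unfolding P1_def by auto

lemma edge:
  assumes "i \<in> verts G" "k \<in> {1..out_degree G i}"
  shows "e i k \<in> arcs G" "tail G (e i k) = i" "arc_coord (e i k) = Ratio i k"
    "head G (e i k) \<in> verts G"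
proof -
  have bij: "bij_betw (e i) {1..out_degree G i} (out_arcs G i)"
    using ordering assms(1) unfolding edge_ordering_def by blast
  hence "e i k \<in> out_arcs G i" using assms(2) by (rule bij_betwE[rule_format])
  thus *: "e i k \<in> arcs G" "tail G (e i k) = i" "head G (e i k) \<in> verts G" by auto
  show "arc_coord (e i k) = Ratio i k"
    unfolding arc_coord_def *(2) using bij assms(2)
    by (simp add: the_inv_into_f_f bij_betw_def)
qed

lemma out_arcs_eq: "i \<in> verts G \<Longrightarrow> out_arcs G i = e i ` {1..out_degree G i}"
  using ordering unfolding edge_ordering_def bij_betw_def by blast

lemma
  assumes "a \<in> arcs G"
  shows arc_coord_in_coords: "arc_coord a \<in> coords G"
    and arc_ratio_less_1: "\<bar>x (arc_coord a)\<bar> < 1"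
    and arc_ratio_nonzero: "x (arc_coord a) \<noteq> 0"
proof -
  have t: "tail G a \<in> verts G" using assms by simp
  have "a \<in> out_arcs G (tail G a)" using assms by simp
  then obtain k where k: "k \<in> {1..out_degree G (tail G a)}" "a = e (tail G a) k"
    unfolding out_arcs_eq[OF t] by blast
  have *: "arc_coord a = Ratio (tail G a) k" using edge(3)[OF t k(1)] k(2) by simp
  show "arc_coord a \<in> coords G" using t k(1) unfolding * coords_def by blast
  show "\<bar>x (arc_coord a)\<bar> < 1" "x (arc_coord a) \<noteq> 0" using ratio[OF t k(1)] by (simp_all add: *)
qed

text \<open>
  The vector \<open>l\<close> is defined through the inverse matrix; rewritten over vertices and edges, its
  equation says that the pieces of a hull and the gaps between them add up to the hull. Positivity
  holds because every vertex has a gap, which makes the right-hand side of \<open>(1 - M) l = \<xi>\<close> positive.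
\<close>

lemma
  assumes i: "i \<in> verts G"
  shows l_equation: "l i = (\<Sum>k\<in>{1..out_degree G i}. \<bar>x (Ratio i k)\<bar> * l (head G (e i k)))
    + (\<Sum>k\<in>{1..out_degree G i - 1}. x (Gap i k))" (is ?eq)
  and l_pos: "l i > 0"
proof -
  define M where "M = M1 G e x"
  define \<xi> where "\<xi> = Matrix.vec N (\<lambda>j. \<Sum>k\<in>{1..out_degree G (Suc j) - 1}. x (Gap (Suc j) k))"
  have N: "card (verts G) = N" "N > 0" using verts i by auto
  have M: "M \<in> carrier_mat N N" unfolding M_def M1_def N by simp
  have sr: "spectral_radius (map_mat complex_of_real M) < 1"
    using param unfolding P1_def M_def by simp
  obtain B where B: "mat_inverse (1\<^sub>m N - M) = Some B" "(1\<^sub>m N - M) * B = 1\<^sub>m N" "B \<in> carrier_mat N N"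
    by (rule mat_inverse_one_minus[OF M sr N(2)])
  define v where "v = B *\<^sub>v \<xi>"
  have \<xi>: "\<xi> \<in> carrier_vec N" by (simp add: \<xi>_def)
  have v: "v \<in> carrier_vec N" unfolding v_def using B(3) \<xi> by simp
  have "(1\<^sub>m N - M) *\<^sub>v v = ((1\<^sub>m N - M) * B) *\<^sub>v \<xi>"
    unfolding v_def using B(3) \<xi> M by (intro assoc_mult_mat_vec[symmetric, of _ N N _ N]) auto
  hence "(1\<^sub>m N - M) *\<^sub>v v = \<xi>" using \<xi> by (simp add: B(2))
  hence eq: "v - M *\<^sub>v v = \<xi>"
    using v M by (subst (asm) minus_mult_distrib_mat_vec[of _ N N]) auto
  have lv: "l i = vec_index v (i - 1)" for i
    unfolding seg_len_def v_def M_def[symmetric] N \<xi>_def B(1) by simp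
  have veq: "l (Suc m) = (\<Sum>j<N. M $$ (m, j) * l (Suc j)) + vec_index \<xi> m" if m: "m < N" for m
  proof -
    have "vec_index (v - M *\<^sub>v v) m = vec_index \<xi> m" by (simp add: eq)
    thus ?thesis using m M v
      by (simp add: lv scalar_prod_def lessThan_atLeast0)
  qed
  have Mlm: "(\<Sum>j<N. M $$ (m, j) * l (Suc j)) =
      (\<Sum>k\<in>{1..out_degree G (Suc m)}. \<bar>x (Ratio (Suc m) k)\<bar> * l (head G (e (Suc m) k)))" if m: "m < N" for m
  proof -
    let ?K = "{1..out_degree G (Suc m)}"
    have "(\<Sum>j<N. M $$ (m, j) * l (Suc j)) =
      (\<Sum>j<N. \<Sum>k\<in>{k \<in> ?K. head G (e (Suc m) k) = Suc j}.
        \<bar>x (Ratio (Suc m) k)\<bar> * l (head G (e (Suc m) k)))"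
    proof (rule sum.cong[OF refl])
      fix j assume j: "j \<in> {..<N}"
      have "M $$ (m, j) = (\<Sum>k\<in>{k \<in> ?K. head G (e (Suc m) k) = Suc j}. \<bar>x (Ratio (Suc m) k)\<bar>)"
        using m j unfolding M_def M1_def N by simp
      thus "M $$ (m, j) * l (Suc j) = (\<Sum>k\<in>{k \<in> ?K. head G (e (Suc m) k) = Suc j}.
          \<bar>x (Ratio (Suc m) k)\<bar> * l (head G (e (Suc m) k)))"
        by (simp only: sum_distrib_right) (rule sum.cong, simp_all)
    qed
    also have "\<dots> = (\<Sum>j\<in>{..<N}. \<Sum>k\<in>{k \<in> ?K. head G (e (Suc m) k) - 1 = j}.
        \<bar>x (Ratio (Suc m) k)\<bar> * l (head G (e (Suc m) k)))"
    proof (intro sum.cong refl)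
      fix j
      have "head G (e (Suc m) k) = Suc j \<longleftrightarrow> head G (e (Suc m) k) - 1 = j" if "k \<in> ?K" for k
      proof -
        have "head G (e (Suc m) k) \<ge> 1" using edge(4)[of "Suc m" k] that m verts by auto
        thus ?thesis by linarith
      qed
      thus "{k \<in> ?K. head G (e (Suc m) k) = Suc j} = {k \<in> ?K. head G (e (Suc m) k) - 1 = j}"
        by blast
    qed
    also have "\<dots> = (\<Sum>k\<in>?K. \<bar>x (Ratio (Suc m) k)\<bar> * l (head G (e (Suc m) k)))"
    proof (rule sum.group)
      show "(\<lambda>k. head G (e (Suc m) k) - 1) ` ?K \<subseteq> {..<N}"
      proof (intro image_subsetI)
        fix k assume "k \<in> ?K"
        hence "head G (e (Suc m) k) \<in> {1..N}" using edge(4)[of "Suc m" k] m verts by auto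
        thus "head G (e (Suc m) k) - 1 \<in> {..<N}" by auto
      qed
    qed auto
    finally show ?thesis .
  qed
  obtain m where m: "i = Suc m" "m < N" using i verts by (cases i) auto
  show ?eq using veq[OF m(2)] Mlm[OF m(2)] m by (simp add: \<xi>_def)
  have "l (Suc m) > 0"
  proof (rule pos_solution_of_nonneg_system[OF M _ sr, where v = "\<lambda>j. l (Suc j)" and w = "vec_index \<xi>"])
    show "0 \<le> M $$ (i, j)" if "i < N" "j < N" for i j
      using that unfolding M_def M1_def N by (auto intro!: sum_nonneg)
    show "0 < vec_index \<xi> i" if "i < N" for i
    proof -
      have i': "Suc i \<in> verts G" using that verts by auto
      have "out_degree G (Suc i) - 1 \<ge> 1" using out_degree[OF i'] by simp
      hence "0 < (\<Sum>k\<in>{1..out_degree G (Suc i) - 1}. x (Gap (Suc i) k))"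
        using gap[OF i'] by (intro sum_pos) auto
      thus ?thesis using that by (simp add: \<xi>_def)
    qed
  qed (rule veq, assumption, rule m(2))
  thus "l i > 0" by (simp add: m)
qed

lemma piece_left_Suc:
  assumes "k \<ge> 1"
  shows "piece_left i (Suc k) = piece_right i k + x (Gap i k)"
  using assms by (cases k) (auto simp: piece_left_def piece_right_def)

lemma piece_left_1: "piece_left i 1 = b i"
  by (simp add: piece_left_def)

lemma piece_right_last:
  assumes i: "i \<in> verts G"
  shows "piece_right i (out_degree G i) = b i + l i"
proof -
  have *: "piece_right i (Suc k) = b i + (\<Sum>k\<in>{1..Suc k}. \<bar>x (Ratio i k)\<bar> * l (head G (e i k)))
      + (\<Sum>k\<in>{1..k}. x (Gap i k))" for k
  proof (induction k)
    case 0
    then show ?case by (simp add: piece_right_def)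
  next
    case (Suc k)
    have "piece_right i (Suc (Suc k)) = piece_left i (Suc (Suc k))
        + \<bar>x (Ratio i (Suc (Suc k)))\<bar> * l (head G (e i (Suc (Suc k))))"
      by (simp add: piece_right_def piece_left_def)
    thus ?case using Suc by (simp add: piece_left_Suc)
  qed
  obtain d where d: "out_degree G i = Suc d" using out_degree[OF i] by (cases "out_degree G i") auto
  show ?thesis using l_equation[OF i] unfolding d * diff_Suc_1 by linarith
qed

lemma gd_map_edge:
  assumes "i \<in> verts G" "k \<in> {1..out_degree G i}"
  shows "gd_map G e x b (e i k) = (\<lambda>t. x (Ratio i k) * t + (piece_left i k
    - x (Ratio i k) * b (head G (e i k)) - x (Ratio i k) * l (head G (e i k)) * of_bool (x (Ratio i k) < 0)))"
proof -
  have inv: "the_inv_into {1..out_degree G i} (e i) (e i k) = k"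
    using edge(2,3)[OF assms] by (simp add: arc_coord_def)
  show ?thesis
    unfolding gd_map_def Let_def edge(2)[OF assms] inv piece_left_def[symmetric]
    by (rule ext) (simp add: algebra_simps)
qed

lemma gd_map_hull:
  assumes "i \<in> verts G" "k \<in> {1..out_degree G i}"
  defines "j \<equiv> head G (e i k)"
  shows "gd_map G e x b (e i k) ` {b j..b j + l j} \<subseteq> {piece_left i k..piece_right i k}"
    and "gd_map G e x b (e i k) ` {b j, b j + l j} = {piece_left i k, piece_right i k}"
proof -
  let ?r = "x (Ratio i k)"
  have r: "piece_right i k = piece_left i k + \<bar>?r\<bar> * l j"
    by (simp add: piece_right_def piece_left_def j_def)
  show "gd_map G e x b (e i k) ` {b j..b j + l j} \<subseteq> {piece_left i k..piece_right i k}"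
  proof (intro image_subsetI)
    fix t assume t: "t \<in> {b j..b j + l j}"
    have *: "0 \<le> \<bar>?r\<bar> * (t - b j)" "0 \<le> \<bar>?r\<bar> * (b j + l j - t)" using t by auto
    show "gd_map G e x b (e i k) t \<in> {piece_left i k..piece_right i k}"
    proof (cases "?r < 0")
      case True
      thus ?thesis using * unfolding gd_map_edge[OF assms(1,2)] r j_def[symmetric]
        by (simp add: abs_of_neg algebra_simps)
    next
      case False
      thus ?thesis using * unfolding gd_map_edge[OF assms(1,2)] r j_def[symmetric]
        by (simp add: algebra_simps)
    qed
  qed
  show "gd_map G e x b (e i k) ` {b j, b j + l j} = {piece_left i k, piece_right i k}"
    unfolding gd_map_edge[OF assms(1,2)] r j_def[symmetric] image_insert image_empty
    by (cases "?r < 0") (simp_all add: algebra_simps insert_commute)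
qed

lemma attractor_pieces:
  assumes i: "i \<in> verts G"
  shows "F i = (\<Union>k\<in>{1..out_degree G i}. gd_map G e x b (e i k) ` F (head G (e i k)))"
proof -
  have "F i = (\<Union>v\<in>verts G. \<Union>a\<in>{a \<in> arcs G. tail G a = i \<and> head G a = v}. gd_map G e x b a ` F v)"
    using attractor i unfolding gd_attractor_def by blast
  also have "\<dots> = (\<Union>a\<in>out_arcs G i. gd_map G e x b a ` F (head G a))"
    by (fastforce simp: out_arcs_def)
  finally show ?thesis unfolding out_arcs_eq[OF i] by simp
qed

lemma gd_map_contracts:
  assumes "i \<in> verts G" "k \<in> {1..out_degree G i}"
  shows "dist (gd_map G e x b (e i k) y) (gd_map G e x b (e i k) z) \<le> \<bar>x (Ratio i k)\<bar> * dist y z"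
  unfolding gd_map_edge[OF assms]
  by (simp add: dist_real_def flip: abs_mult right_diff_distrib)

lemma piece_in_hull:
  assumes i: "i \<in> verts G" and k: "k \<in> {1..out_degree G i}"
  shows "{piece_left i k..piece_right i k} \<subseteq> {b i..b i + l i}"
proof -
  have le: "piece_left i k \<le> piece_right i k" if "k \<in> {1..out_degree G i}" for k
    using l_pos[OF edge(4)[OF i that]] by (simp add: piece_left_def piece_right_def)
  have sep: "piece_right i k \<le> piece_left i (Suc k)" if "1 \<le> k" "k < out_degree G i" for k
    using piece_left_Suc[of k i] gap[OF i, of k] that by fastforce
  have "piece_left i 1 \<le> piece_left i k"
    using k le sep
  proof -
    have "1 \<le> k" "k \<le> out_degree G i" using k by auto
    thus ?thesis
    proof (induction k rule: dec_induct)
      case (step k)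
      thus ?case using le[of k] sep[of k] by force
    qed simp
  qed
  moreover have "piece_right i k \<le> piece_right i (out_degree G i)"
  proof -
    have "k \<le> out_degree G i" "1 \<le> k" using k by auto
    thus ?thesis
    proof (induction k rule: inc_induct)
      case (step k)
      thus ?case using le[of "Suc k"] sep[of k] by force
    qed simp
  qed
  ultimately show ?thesis using piece_left_1[of i] piece_right_last[OF i] by simp
qed

text \<open>
  The hulls are mapped into hulls, so they contain the attractors.
\<close>

lemma attractor_in_hull:
  assumes "i \<in> verts G"
  shows "F i \<subseteq> {b i..b i + l i}"
proof (rule contracting_family_subset[where V = "verts G" and K = F and C = "\<lambda>i. {b i..b i + l i}"])
  fix v t assume v: "v \<in> verts G" and t: "t \<in> F v"
  obtain k s where k: "k \<in> {1..out_degree G v}" "s \<in> F (head G (e v k))"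
    "t = gd_map G e x b (e v k) s"
    using subsetD[OF equalityD1[OF attractor_pieces[OF v]] t] by blast
  have "gd_map G e x b (e v k) ` {b (head G (e v k))..b (head G (e v k)) + l (head G (e v k))} \<subseteq> {b v..b v + l v}"
    using gd_map_hull(1)[OF v k(1)] piece_in_hull[OF v k(1)] by blast
  thus "\<exists>w\<in>verts G. \<exists>s\<in>F w. \<exists>f r. r < 1 \<and> (\<forall>y z. dist (f y) (f z) \<le> r * dist y z) \<and> t = f s \<and>
      f ` {b w..b w + l w} \<subseteq> {b v..b v + l v}"
    using gd_map_contracts[OF v k(1)] ratio(2)[OF v k(1)] k edge(4)[OF v k(1)] by blast
next
  show "compact (F v)" if "v \<in> verts G" for v
    using attractor that unfolding gd_attractor_def by blast
  show "closed {b v..b v + l v} \<and> {b v..b v + l v} \<noteq> {}" if "v \<in> verts G" for v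
    using l_pos[OF that] by simp
qed (use assms in auto)

text \<open>
  Every end point of a hull is the image of an end point of another hull, under the first or the last
  edge. A family of finite sets covered by its own images in this way is contained in the attractors.
\<close>

lemma hull_endpoints_in_attractor:
  assumes "i \<in> verts G"
  shows "{b i, b i + l i} \<subseteq> F i"
proof (rule contracting_family_subset[where V = "verts G" and K = "\<lambda>i. {b i, b i + l i}" and C = F])
  fix v t assume v: "v \<in> verts G" and t: "t \<in> {b v, b v + l v}"
  obtain k where k: "k \<in> {1..out_degree G v}" "t \<in> {piece_left v k, piece_right v k}"
  proof (cases "t = b v")
    case True
    have "1 \<in> {1..out_degree G v}" using out_degree[OF v] by simp
    thus ?thesis by (rule that) (simp only: piece_left_1 True insertI1)
  next
    case False
    hence "t = piece_right v (out_degree G v)" using t piece_right_last[OF v] by simp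
    hence "t \<in> {piece_left v (out_degree G v), piece_right v (out_degree G v)}" by simp
    moreover have "out_degree G v \<in> {1..out_degree G v}" using out_degree[OF v] by simp
    ultimately show ?thesis by (intro that)
  qed
  then obtain s where s: "s \<in> {b (head G (e v k)), b (head G (e v k)) + l (head G (e v k))}"
    "t = gd_map G e x b (e v k) s"
    using gd_map_hull(2)[OF v k(1)] by blast
  have "gd_map G e x b (e v k) ` F (head G (e v k)) \<subseteq> F v"
    using equalityD2[OF attractor_pieces[OF v]] k(1) by blast
  thus "\<exists>w\<in>verts G. \<exists>s\<in>{b w, b w + l w}. \<exists>f r. r < 1 \<and> (\<forall>y z. dist (f y) (f z) \<le> r * dist y z) \<and> t = f s \<and>
      f ` F w \<subseteq> F v"
    using gd_map_contracts[OF v k(1)] ratio(2)[OF v k(1)] s edge(4)[OF v k(1)] by blast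
next
  show "closed (F v) \<and> F v \<noteq> {}" if "v \<in> verts G" for v
    using attractor that unfolding gd_attractor_def by (blast intro: compact_imp_closed)
qed (use assms in auto)

text \<open>
  The gaps of level one have the lengths prescribed by the parameters; every other gap is a scaled copy of
  a gap at the head of an edge.
\<close>

lemma gap_lengths_step:
  assumes i: "i \<in> verts G"
  shows "gap_lengths (F i) = {x (Gap i k) |k. k \<in> {1..out_degree G i - 1}} \<union>
    (\<Union>a\<in>out_arcs G i. (*) \<bar>x (arc_coord a)\<bar> ` gap_lengths (F (head G a)))"
proof -
  define A where "A k = gd_map G e x b (e i k) ` F (head G (e i k))" for k
  have "gap_lengths (\<Union>k\<in>{1..out_degree G i}. A k) =
      {piece_left i (Suc k) - piece_right i k |k. k \<in> {1..out_degree G i - 1}} \<union>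
      (\<Union>k\<in>{1..out_degree G i}. gap_lengths (A k))"
  proof (rule gap_lengths_separated_union)
    fix k assume k: "k \<in> {1..out_degree G i}"
    note h = edge(4)[OF i k]
    have "A k \<subseteq> {piece_left i k..piece_right i k}"
      unfolding A_def using attractor_in_hull[OF h] gd_map_hull(1)[OF i k] by blast
    moreover have "{piece_left i k, piece_right i k} \<subseteq> A k"
      unfolding A_def gd_map_hull(2)[OF i k, symmetric]
      by (rule image_mono[OF hull_endpoints_in_attractor[OF h]])
    ultimately show "A k \<subseteq> {piece_left i k..piece_right i k} \<and> piece_left i k \<in> A k \<and> piece_right i k \<in> A k"
      by blast
  next
    fix k assume "k \<in> {1..out_degree G i - 1}"
    thus "piece_right i k < piece_left i (Suc k)" using gap[OF i, of k] piece_left_Suc[of k i] by simp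
  qed
  also have "(\<Union>k\<in>{1..out_degree G i}. A k) = F i"
    unfolding A_def using attractor_pieces[OF i] by simp
  also have "{piece_left i (Suc k) - piece_right i k |k. k \<in> {1..out_degree G i - 1}} =
      {x (Gap i k) |k. k \<in> {1..out_degree G i - 1}}"
  proof -
    have "piece_left i (Suc k) - piece_right i k = x (Gap i k)" if "k \<in> {1..out_degree G i - 1}" for k
      using that by (simp add: piece_left_Suc)
    thus ?thesis by (intro Collect_cong) metis
  qed
  also have "(\<Union>k\<in>{1..out_degree G i}. gap_lengths (A k)) =
      (\<Union>k\<in>{1..out_degree G i}. (*) \<bar>x (arc_coord (e i k))\<bar> ` gap_lengths (F (head G (e i k))))"
  proof (intro SUP_cong refl)
    fix k assume k: "k \<in> {1..out_degree G i}"
    show "gap_lengths (A k) = (*) \<bar>x (arc_coord (e i k))\<bar> ` gap_lengths (F (head G (e i k)))"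
      unfolding A_def gd_map_edge[OF i k] edge(3)[OF i k] by (rule gap_lengths_affine[OF ratio(1)[OF i k]])
  qed
  finally show ?thesis unfolding out_arcs_eq[OF i] by simp
qed


section \<open>Gap lengths as monomials along walks\<close>

text \<open>
  Monomials in the parameters are represented by multisets of coordinates, so that admissibility becomes
  injectivity and the composition of walks becomes the union of multisets.
\<close>

definition monomial :: "coord multiset \<Rightarrow> real" where
  "monomial A = (\<Prod>c\<in>#A. \<bar>x c\<bar>)"

definition walk_coords :: "'e list \<Rightarrow> coord multiset" where
  "walk_coords p = image_mset arc_coord (mset p)"

lemma monomial_simps [simp]:
  "monomial {#} = 1" "monomial (add_mset c A) = \<bar>x c\<bar> * monomial A"
  "monomial (A + B) = monomial A * monomial B"
  by (simp_all add: monomial_def)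

lemma walk_coords_simps [simp]:
  "walk_coords [] = {#}" "walk_coords (a # p) = add_mset (arc_coord a) (walk_coords p)"
  "walk_coords (p @ q) = walk_coords p + walk_coords q"
  by (simp_all add: walk_coords_def)

lemma walk_monomial_bounds:
  assumes "set p \<subseteq> arcs G"
  shows "0 < monomial (walk_coords p)" "p \<noteq> [] \<Longrightarrow> monomial (walk_coords p) < 1"
proof -
  have *: "0 < monomial (walk_coords p) \<and> monomial (walk_coords p) \<le> 1" if "set p \<subseteq> arcs G" for p
    using that
  proof (induction p)
    case (Cons a p)
    thus ?case using arc_ratio_less_1[of a] arc_ratio_nonzero[of a] by (auto intro!: mult_le_one)
  qed simp
  show "0 < monomial (walk_coords p)" using *[OF assms] by simp
  assume "p \<noteq> []"
  then obtain a q where p: "p = a # q" by (cases p) auto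
  have a: "a \<in> arcs G" "set q \<subseteq> arcs G" using assms p by auto
  have "\<bar>x (arc_coord a)\<bar> * monomial (walk_coords q) \<le> \<bar>x (arc_coord a)\<bar> * 1"
    using *[OF a(2)] by (intro mult_left_mono) auto
  thus "monomial (walk_coords p) < 1" using arc_ratio_less_1[OF a(1)] by (simp add: p)
qed

lemma walk_monomial_in_gap_lengths:
  assumes "awalk i p j" "k \<in> {1..out_degree G j - 1}"
  shows "monomial (add_mset (Gap j k) (walk_coords p)) \<in> gap_lengths (F i)"
  using assms(1)
proof (induction p arbitrary: i)
  case Nil
  hence "i = j" "j \<in> verts G" by (auto simp: awalk_def)
  moreover have "\<bar>x (Gap j k)\<bar> = x (Gap j k)" using gap[of j k] assms(2) \<open>j \<in> verts G\<close> by simp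
  ultimately show ?case using assms(2) by (subst gap_lengths_step) auto
next
  case (Cons a p)
  hence a: "a \<in> arcs G" "i = tail G a" "awalk (head G a) p j" by (auto simp: awalk_Cons_iff)
  have "monomial (add_mset (Gap j k) (walk_coords (a # p))) =
      \<bar>x (arc_coord a)\<bar> * monomial (add_mset (Gap j k) (walk_coords p))"
    by (simp add: mult_ac)
  also have "\<dots> \<in> (\<Union>a\<in>out_arcs G i. (*) \<bar>x (arc_coord a)\<bar> ` gap_lengths (F (head G a)))"
    using a Cons.IH[OF a(3)] by auto
  finally show ?case using a by (subst gap_lengths_step) auto
qed

lemma gap_length_bounds:
  assumes "i \<in> verts G" "g \<in> gap_lengths (F i)"
  shows "0 < g" "g \<le> l i"
proof -
  obtain a b' where ab: "a \<in> F i" "b' \<in> F i" "a < b'" "g = b' - a"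
    using assms(2) unfolding gap_lengths_def by blast
  have "b i \<le> a" "b' \<le> b i + l i" using ab(1,2) attractor_in_hull[OF assms(1)] by auto
  thus "0 < g" "g \<le> l i" using ab(3,4) by auto
qed

text \<open>
  Unfold \<open>gap_lengths_step\<close> repeatedly. Passing to the head of an edge enlarges the gap length by at
  least the factor \<open>1 / R\<close>, where \<open>R < 1\<close> is the largest ratio, while gap lengths are bounded by the
  total length \<open>L\<close> of all hulls; so a gap of length above \<open>R ^ n * L\<close> is reached within \<open>n\<close> steps.
\<close>

lemma gap_length_walk:
  assumes i: "i \<in> verts G" and g: "g \<in> gap_lengths (F i)"
  obtains p j k where "awalk i p j" "k \<in> {1..out_degree G j - 1}"
    "g = monomial (add_mset (Gap j k) (walk_coords p))"
proof -
  define R where "R = Max ((\<lambda>a. \<bar>x (arc_coord a)\<bar>) ` arcs G)"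
  define L where "L = (\<Sum>i\<in>verts G. l i)"
  have lL: "l i \<le> L" if "i \<in> verts G" for i
    unfolding L_def using that l_pos by (intro member_le_sum) (auto simp: less_imp_le)
  have L: "L > 0" using lL[OF i] l_pos[OF i] by simp
  have "1 \<in> {1..out_degree G i}" using out_degree[OF i] by simp
  hence ne: "e i 1 \<in> arcs G" using edge(1)[OF i] by blast
  have xR: "\<bar>x (arc_coord a)\<bar> \<le> R" if "a \<in> arcs G" for a
    unfolding R_def using that by (intro Max_ge) auto
  have R: "0 < R" "R < 1"
  proof -
    show "0 < R" using xR[OF ne] arc_ratio_nonzero[OF ne] by simp
    have "R \<in> (\<lambda>a. \<bar>x (arc_coord a)\<bar>) ` arcs G" unfolding R_def using ne by (intro Max_in) auto
    thus "R < 1" using arc_ratio_less_1 by auto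
  qed
  have *: "\<exists>p j k. awalk i p j \<and> k \<in> {1..out_degree G j - 1} \<and>
      g = monomial (add_mset (Gap j k) (walk_coords p))"
    if "i \<in> verts G" "g \<in> gap_lengths (F i)" "R ^ n * L < g" for n i g
    using that
  proof (induction n arbitrary: i g)
    case 0
    thus ?case using gap_length_bounds(2)[OF 0(1,2)] lL[OF 0(1)] by simp
  next
    case (Suc n)
    consider k where "k \<in> {1..out_degree G i - 1}" "g = x (Gap i k)"
      | a g' where "a \<in> out_arcs G i" "g' \<in> gap_lengths (F (head G a))" "g = \<bar>x (arc_coord a)\<bar> * g'"
      using Suc.prems(2) unfolding gap_lengths_step[OF Suc.prems(1)] by blast
    thus ?case
    proof cases
      case 1
      moreover have "awalk i [] i" using Suc.prems(1) by (simp add: awalk_Nil_iff)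
      moreover have "x (Gap i k) > 0" using gap[OF Suc.prems(1) 1(1)] .
      ultimately show ?thesis
        by (intro exI[of _ "[]"] exI[of _ i] exI[of _ k]) simp
    next
      case 2
      hence a: "a \<in> arcs G" "tail G a = i" "head G a \<in> verts G" by auto
      have "R * (R ^ n * L) < \<bar>x (arc_coord a)\<bar> * g'" using Suc.prems(3) 2(3) by (simp add: mult_ac)
      also have "\<dots> \<le> R * g'"
        using xR[OF a(1)] gap_length_bounds(1)[OF a(3) 2(2)] by (intro mult_right_mono) auto
      finally have "R ^ n * L < g'" using R by simp
      from Suc.IH[OF a(3) 2(2) this] obtain p j k where
        p: "awalk (head G a) p j" "k \<in> {1..out_degree G j - 1}"
        "g' = monomial (add_mset (Gap j k) (walk_coords p))" by blast
      have "awalk i (a # p) j" using p a by (simp add: awalk_Cons_iff)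
      moreover have "g = monomial (add_mset (Gap j k) (walk_coords (a # p)))"
        using p(3) 2(3) by (simp add: mult_ac)
      ultimately show ?thesis using p(2) by blast
    qed
  qed
  have "0 < g / L" using gap_length_bounds(1)[OF i g] L by simp
  then obtain n where "R ^ n < g / L" using real_arch_pow_inv R by blast
  hence "R ^ n * L < g" using L by (simp add: pos_less_divide_eq)
  thus ?thesis using *[OF i g] that by blast
qed

lemma finite_coords: "finite (coords G)"
proof (rule card_coords(1)[OF fin_digraph_axioms])
  show "\<forall>i\<in>verts G. 1 \<le> out_degree G i" using out_degree by fastforce
qed

lemma coord_nonzero: "c \<in> coords G \<Longrightarrow> x c \<noteq> 0"
  using ratio gap unfolding coords_def by fastforce

lemma monomial_eq_prod:
  assumes "set_mset A \<subseteq> coords G"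
  shows "monomial A = (\<Prod>c\<in>coords G. \<bar>x c\<bar> powr of_rat (of_nat (count A c)))"
proof -
  have "monomial A = (\<Prod>c\<in>coords G. \<bar>x c\<bar> ^ count A c)"
    using assms
  proof (induction A)
    case (add a A)
    have "(\<Prod>c\<in>coords G. \<bar>x c\<bar> ^ count (add_mset a A) c) =
        (\<Prod>c\<in>coords G. (if c = a then \<bar>x c\<bar> else 1) * \<bar>x c\<bar> ^ count A c)"
      by (intro prod.cong) auto
    also have "\<dots> = \<bar>x a\<bar> * (\<Prod>c\<in>coords G. \<bar>x c\<bar> ^ count A c)"
      using add.prems finite_coords by (simp add: prod.distrib)
    finally show ?case using add by simp
  qed simp
  also have "\<dots> = (\<Prod>c\<in>coords G. \<bar>x c\<bar> powr of_rat (of_nat (count A c)))"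
    using coord_nonzero by (intro prod.cong) (auto simp: powr_realpow)
  finally show ?thesis .
qed

section \<open>Admissible parameters\<close>

lemma monomial_inj:
  assumes adm: "admissible G x" and AB: "set_mset A \<subseteq> coords G" "set_mset B \<subseteq> coords G"
    and eq: "monomial A = monomial B"
  shows "A = B"
proof (rule multiset_eqI)
  fix c
  show "count A c = count B c"
  proof (rule ccontr)
    assume ne: "count A c \<noteq> count B c"
    hence "c \<in> coords G" using AB by (metis in_mono not_in_iff)
    hence "\<exists>c\<in>coords G. (of_nat (count A c) :: rat) \<noteq> of_nat (count B c)" using ne by auto
    thus False using adm eq unfolding monomial_eq_prod[OF AB(1)] monomial_eq_prod[OF AB(2)] admissible_def
      by (elim allE[of _ "\<lambda>c. of_nat (count A c)"] allE[of _ "\<lambda>c. of_nat (count B c)"]) auto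
  qed
qed

lemma walk_coords_in_coords:
  assumes "awalk i p j"
  shows "set_mset (walk_coords p) \<subseteq> coords G"
  using assms arc_coord_in_coords unfolding walk_coords_def awalk_def by auto

lemma gap_in_coords: "j \<in> verts G \<Longrightarrow> k \<in> {1..out_degree G j - 1} \<Longrightarrow> Gap j k \<in> coords G"
  unfolding coords_def by blast

lemma Gap_notin_walk_coords [simp]: "Gap j k \<notin># walk_coords p"
  by (auto simp: walk_coords_def arc_coord_def)

text \<open>
  The monomial of a walk consists of ratios alone; the gap coordinate of a gap length is therefore
  visible in its multiset, and with it the vertex where the walk ends.
\<close>

lemma single_gap_eq:
  assumes "add_mset (Gap j k) (walk_coords p) = add_mset (Gap j' k') (walk_coords q)"
  shows "j = j'" "walk_coords p = walk_coords q"
proof -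
  have "Gap j k \<in># add_mset (Gap j' k') (walk_coords q)" by (simp flip: assms)
  hence "Gap j k = Gap j' k'" by simp
  thus "j = j'" "walk_coords p = walk_coords q" using assms by simp_all
qed

text \<open>
  Let \<open>\<rho>\<close> be the ratio and \<open>g\<close> the gap length \<open>Gap u 1\<close>. Then \<open>\<rho> g\<close> and \<open>\<rho>\<^sup>2 g\<close> are gap lengths,
  each a product of ratios and of a single gap coordinate, and \<open>(\<rho> g)\<^sup>2 = g (\<rho>\<^sup>2 g)\<close>. The left-hand side
  contains the gap coordinate of \<open>\<rho> g\<close> twice and the right-hand side contains \<open>Gap u 1\<close>; by
  admissibility the gap coordinate of \<open>\<rho> g\<close> is \<open>Gap u 1\<close>, which means that its walk returns to \<open>u\<close>.
\<close>

lemma COSC_ratio_is_closed_walk: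
  assumes adm: "admissible G x" and u: "u \<in> verts G"
    and I: "standard_ifs I" "COSC I" "ifs_attractor I (F u)" and f: "f \<in> I"
  obtains p where "awalk u p u" "p \<noteq> []" "contraction_ratio f = monomial (walk_coords p)"
proof -
  let ?\<rho> = "contraction_ratio f"
  have one: "1 \<in> {1..out_degree G u - 1}" using out_degree[OF u] by simp
  define g where "g = \<bar>x (Gap u 1)\<bar>"
  have "awalk u [] u" using u by (simp add: awalk_Nil_iff)
  from walk_monomial_in_gap_lengths[OF this one]
  have g: "g \<in> gap_lengths (F u)" by (simp add: g_def)
  have g1: "?\<rho> * g \<in> gap_lengths (F u)" by (rule COSC_scaled_gaps[OF I f g])
  have g2: "?\<rho> * (?\<rho> * g) \<in> gap_lengths (F u)" by (rule COSC_scaled_gaps[OF I f g1])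
  obtain p j k where p: "awalk u p j" "k \<in> {1..out_degree G j - 1}"
    "?\<rho> * g = monomial (add_mset (Gap j k) (walk_coords p))" by (rule gap_length_walk[OF u g1])
  obtain p' j' k' where p': "awalk u p' j'" "k' \<in> {1..out_degree G j' - 1}"
    "?\<rho> * (?\<rho> * g) = monomial (add_mset (Gap j' k') (walk_coords p'))" by (rule gap_length_walk[OF u g2])
  let ?A = "add_mset (Gap j k) (walk_coords p) + add_mset (Gap j k) (walk_coords p)"
  let ?B = "add_mset (Gap u 1) (add_mset (Gap j' k') (walk_coords p'))"
  have "monomial ?A = (?\<rho> * g) * (?\<rho> * g)" unfolding p(3) by (simp only: monomial_simps(3))
  also have "\<dots> = g * (?\<rho> * (?\<rho> * g))" by simp
  also have "\<dots> = monomial ?B"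
    unfolding p'(3) monomial_simps(2)[of "Gap u 1"] g_def[symmetric] by (rule refl)
  finally have eq: "monomial ?A = monomial ?B" .
  have jj: "j \<in> verts G" "j' \<in> verts G" using p(1) p'(1) by (blast dest: awalk_last_in_verts)+
  have "?A = ?B"
  proof (rule monomial_inj[OF adm _ _ eq])
    show "set_mset ?A \<subseteq> coords G"
      using walk_coords_in_coords[OF p(1)] gap_in_coords[OF jj(1) p(2)] by simp
    show "set_mset ?B \<subseteq> coords G"
      using walk_coords_in_coords[OF p'(1)] gap_in_coords[OF jj(2) p'(2)] gap_in_coords[OF u one] by simp
  qed
  hence "Gap u 1 \<in># ?A" by simp
  hence jk: "j = u" "k = 1" by auto
  have "?\<rho> * g = g * monomial (walk_coords p)" using p(3) by (simp add: jk g_def)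
  moreover have "g > 0" using gap_length_bounds(1)[OF u g] .
  ultimately have \<rho>: "?\<rho> = monomial (walk_coords p)" by simp
  have "?\<rho> < 1" using I(1) f contraction_ratio_less_1 unfolding standard_ifs_def by blast
  hence "p \<noteq> []" using \<rho> by auto
  thus ?thesis using that p(1) \<rho> jk by blast
qed

text \<open>
  For the multiset of a walk this is the number of edges of the walk that leave \<open>u\<close>. It is read off
  from the multiset because admissibility determines a walk only up to the order of its edges.
\<close>

definition departures :: "nat \<Rightarrow> coord multiset \<Rightarrow> nat" where
  "departures u A = size {#c \<in># A. \<exists>k. c = Ratio u k#}"

lemma departures_simps [simp]:
  "departures u (A + B) = departures u A + departures u B"
  by (simp add: departures_def)

lemma departures_walk_coords:
  "departures u (walk_coords p) = length (filter (\<lambda>a. tail G a = u) p)"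
  by (induction p) (auto simp: departures_def arc_coord_def)

text \<open>
  Among the walks from \<open>u\<close> to the vertex \<open>v\<close> of the circuit, take one with the fewest departures
  from \<open>u\<close> and let it be followed by \<open>n\<close> rounds of the circuit, which never departs from \<open>u\<close>. The resulting
  gap lengths are infinitely many, so one of them is the product of a contraction ratio, which is the
  monomial of a closed walk at \<open>u\<close>, and of another gap length. By admissibility the latter
  comes from a walk from \<open>u\<close> to \<open>v\<close>. The closed walk departs from \<open>u\<close> at least once, so this walk has
  fewer departures than the minimum.
\<close>

lemma attractor_not_COSC:
  assumes adm: "admissible G x" and u: "u \<in> verts G" and conn: "strongly_conn G"
    and circ: "directed_path G v c v" "\<not> passes_through G c u"
    and I: "standard_ifs I" "COSC I" "ifs_attractor I (F u)"
  shows False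
proof -
  have c: "c \<noteq> []" "awalk v c v" using circ(1) unfolding directed_path_def by auto
  have v: "v \<in> verts G" using c(2) by (simp add: awalk_def)
  have one: "1 \<in> {1..out_degree G v - 1}" using out_degree[OF v] by simp
  have dc: "departures u (walk_coords c) = 0"
    using circ(2) unfolding departures_walk_coords passes_through_def by (auto simp: filter_empty_conv)
  have "\<exists>p. awalk u p v" using conn u v unfolding strongly_conn_def directed_path_def by blast
  then obtain p where p: "awalk u p v"
    "\<And>q. awalk u q v \<Longrightarrow> departures u (walk_coords p) \<le> departures u (walk_coords q)"
    using ex_has_least_nat[of "\<lambda>p. awalk u p v" _ "\<lambda>p. departures u (walk_coords p)"] by blast
  define w where "w n = p @ concat (replicate n c)" for n
  have w: "awalk u (w n) v" for n
  proof -
    have "awalk v (concat (replicate n c)) v"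
    proof (induction n)
      case (Suc n)
      thus ?case using c(2) by (simp only: replicate_Suc concat.simps) (rule awalk_appendI)
    qed (use v in \<open>simp add: awalk_Nil_iff\<close>)
    thus ?thesis unfolding w_def by (rule awalk_appendI[OF p(1)])
  qed
  have dw: "departures u (walk_coords (w n)) = departures u (walk_coords p)" for n
    by (induction n) (auto simp: w_def dc)
  define g where "g n = monomial (add_mset (Gap v 1) (walk_coords (w n)))" for n
  have g: "g n \<in> gap_lengths (F u)" for n
    unfolding g_def by (rule walk_monomial_in_gap_lengths[OF w one])
  have m: "0 < monomial (walk_coords c)" "monomial (walk_coords c) < 1"
    using walk_monomial_bounds[of c] c by (auto simp: awalk_def)
  have g_Suc: "g (Suc n) = monomial (walk_coords c) * g n" for n
    by (simp add: g_def w_def mult_ac)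
  have g_less: "g (Suc n) < g n" for n
    using mult_strict_right_mono[OF m(2) gap_length_bounds(1)[OF u g[of n]]] by (simp add: g_Suc)
  have dec: "g n' < g n" if "n < n'" for n n'
    using that by (induction rule: less_Suc_induct) (blast intro: g_less less_trans)+
  have "inj g"
  proof (rule linorder_injI)
    fix n n' :: nat assume "n < n'"
    thus "g n \<noteq> g n'" using dec[of n n'] by simp
  qed
  hence inf: "infinite (range g)" by (rule range_inj_infinite)
  obtain B where B: "finite B"
    "gap_lengths (F u) \<subseteq> B \<union> (\<Union>f\<in>I. (*) (contraction_ratio f) ` gap_lengths (F u))"
    by (rule COSC_gaps_decompose[OF I])
  have "\<not> range g \<subseteq> B" using inf finite_subset[OF _ B(1)] by blast
  then obtain n where "g n \<notin> B" by blast
  then obtain f g' where f: "f \<in> I" "g' \<in> gap_lengths (F u)" "g n = contraction_ratio f * g'"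
    using B(2) g[of n] by blast
  obtain q where q: "awalk u q u" "q \<noteq> []" "contraction_ratio f = monomial (walk_coords q)"
    by (rule COSC_ratio_is_closed_walk[OF adm u I f(1)])
  obtain p' j k where p': "awalk u p' j" "k \<in> {1..out_degree G j - 1}"
    "g' = monomial (add_mset (Gap j k) (walk_coords p'))" by (rule gap_length_walk[OF u f(2)])
  have j: "j \<in> verts G" using p'(1) by (blast dest: awalk_last_in_verts)
  have eq: "monomial (add_mset (Gap v 1) (walk_coords (w n))) =
      monomial (add_mset (Gap j k) (walk_coords (q @ p')))"
    using f(3) q(3) p'(3) by (simp add: g_def mult_ac)
  have qp': "awalk u (q @ p') j" using q(1) p'(1) by (rule awalk_appendI)
  have "add_mset (Gap v 1) (walk_coords (w n)) = add_mset (Gap j k) (walk_coords (q @ p'))"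
    using walk_coords_in_coords[OF w] walk_coords_in_coords[OF qp'] gap_in_coords[OF v one]
      gap_in_coords[OF j p'(2)]
    by (intro monomial_inj[OF adm _ _ eq]) auto
  note single = single_gap_eq[OF this]
  have "departures u (walk_coords p) = departures u (walk_coords q) + departures u (walk_coords p')"
    using arg_cong[OF single(2), of "departures u"] by (simp add: dw)
  moreover have "departures u (walk_coords p) \<le> departures u (walk_coords p')"
    using p(2)[of p'] p'(1) single(1) by simp
  moreover have "departures u (walk_coords q) > 0"
  proof -
    obtain a q' where aq: "q = a # q'" using q(2) by (cases q) auto
    hence "tail G a = u" using q(1) by (simp add: awalk_Cons_iff)
    thus ?thesis unfolding aq departures_walk_coords by simp
  qed
  ultimately show False by simp
qed

end


section \<open>Almost every parameter is admissible\<close>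

text \<open>
  By Fubini's theorem, integrating over the coordinate \<open>c\<close> first.
\<close>

lemma null_sets_PiM_finite_sections:
  fixes A :: "('i \<Rightarrow> real) set"
  assumes I: "finite I" "c \<in> I" and A: "A \<in> sets (\<Pi>\<^sub>M i\<in>I. lborel)"
    and sections: "\<And>y. finite {t. y(c := t) \<in> A}"
  shows "A \<in> null_sets (\<Pi>\<^sub>M i\<in>I. lborel)"
proof -
  interpret product_sigma_finite "\<lambda>_::'i. lborel :: real measure" by standard
  define J where "J = I - {c}"
  have J: "insert c J = I" "finite J" "c \<notin> J" using I unfolding J_def by auto
  have sec: "(\<integral>\<^sup>+ t. indicator A (y(c := t)) \<partial>lborel) = (0::ennreal)" for y
  proof -
    have null: "{t. y(c := t) \<in> A} \<in> null_sets lborel"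
      using sections[of y] by (intro countable_imp_null_set_lborel countable_finite)
    have "(\<integral>\<^sup>+ t. indicator A (y(c := t)) \<partial>lborel) =
        (\<integral>\<^sup>+ t. indicator {t. y(c := t) \<in> A} t \<partial>lborel)"
      by (intro nn_integral_cong) (simp add: indicator_def)
    also have "\<dots> = emeasure lborel {t. y(c := t) \<in> A}"
      using null by (intro nn_integral_indicator) auto
    finally show ?thesis using null by auto
  qed
  have "emeasure (\<Pi>\<^sub>M i\<in>I. lborel) A = (\<integral>\<^sup>+ y. indicator A y \<partial>(\<Pi>\<^sub>M i\<in>I. lborel))"
    using A by simp
  also have "\<dots> = (\<integral>\<^sup>+ y. (\<integral>\<^sup>+ t. indicator A (y(c := t)) \<partial>lborel) \<partial>(\<Pi>\<^sub>M i\<in>J. lborel))"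
    using A unfolding J(1)[symmetric] by (intro product_nn_integral_insert J) auto
  finally show ?thesis using A by (auto simp: sec null_sets_def)
qed

lemma abs_eq_of_monomial_relation:
  fixes C D s \<alpha> \<beta> :: real
  assumes "s \<noteq> 0" "C > 0" "D > 0" "\<alpha> \<noteq> \<beta>" "\<bar>s\<bar> powr \<alpha> * C = \<bar>s\<bar> powr \<beta> * D"
  shows "\<bar>s\<bar> = (D / C) powr (1 / (\<alpha> - \<beta>))"
proof -
  have "\<bar>s\<bar> powr (\<alpha> - \<beta>) = D / C"
    using assms by (simp add: powr_diff field_simps)
  hence "(D / C) powr (1 / (\<alpha> - \<beta>)) = (\<bar>s\<bar> powr (\<alpha> - \<beta>)) powr (1 / (\<alpha> - \<beta>))" by simp
  also have "\<dots> = \<bar>s\<bar>" using assms(1,4) by (simp add: powr_powr)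
  finally show ?thesis by simp
qed

text \<open>
  If the other coordinates are fixed and nonzero, a relation in which the exponents of the coordinate
  \<open>c\<close> differ determines \<open>\<bar>x c\<bar>\<close>, which leaves at most two values for \<open>x c\<close>.
\<close>

lemma null_set_monomial_relation:
  fixes p q :: "'i \<Rightarrow> real"
  assumes I: "finite I" "c \<in> I" and pq: "p c \<noteq> q c"
  shows "{x \<in> space (\<Pi>\<^sub>M i\<in>I. lborel). (\<Prod>i\<in>I. x i) \<noteq> 0 \<and>
      (\<Prod>i\<in>I. \<bar>x i\<bar> powr p i) = (\<Prod>i\<in>I. \<bar>x i\<bar> powr q i)} \<in> null_sets (\<Pi>\<^sub>M i\<in>I. lborel)"
    (is "?Z \<in> _")
proof (rule null_sets_PiM_finite_sections[OF I])
  let ?M = "\<Pi>\<^sub>M i\<in>I. (lborel :: real measure)"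
  have comp: "(\<lambda>x. x i) \<in> borel_measurable ?M" if "i \<in> I" for i
    using measurable_component_singleton[OF that, of "\<lambda>_. lborel :: real measure"] by simp
  define \<pi> where "\<pi> x = (\<Prod>i\<in>I. x i)" for x :: "'i \<Rightarrow> real"
  define \<mu> where "\<mu> r x = (\<Prod>i\<in>I. \<bar>x i\<bar> powr r i)" for r x :: "'i \<Rightarrow> real"
  have \<pi>: "\<pi> \<in> borel_measurable ?M"
    unfolding \<pi>_def by (intro borel_measurable_prod comp)
  have \<mu>: "\<mu> r \<in> borel_measurable ?M" for r
    unfolding \<mu>_def by (intro borel_measurable_prod measurable_abs_powr comp)
  have "{x \<in> space ?M. \<pi> x \<noteq> 0 \<and> \<mu> p x = \<mu> q x} \<in> sets ?M"
    by (intro sets.sets_Collect_conj borel_measurable_neq borel_measurable_eq \<pi> \<mu> borel_measurable_const)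
  thus "?Z \<in> sets ?M" unfolding \<pi>_def \<mu>_def .
  fix y
  define C where "C r = (\<Prod>i\<in>I - {c}. \<bar>y i\<bar> powr r i)" for r :: "'i \<Rightarrow> real"
  define s where "s = (C q / C p) powr (1 / (p c - q c))"
  have split: "(\<Prod>i\<in>I. \<bar>(y(c := t)) i\<bar> powr r i) = \<bar>t\<bar> powr r c * C r" for t r
    using I unfolding C_def by (simp add: prod.remove)
  have "{t. y(c := t) \<in> ?Z} \<subseteq> {s, - s}"
  proof
    fix t assume "t \<in> {t. y(c := t) \<in> ?Z}"
    hence ne: "(\<Prod>i\<in>I. (y(c := t)) i) \<noteq> 0" and eq: "\<bar>t\<bar> powr p c * C p = \<bar>t\<bar> powr q c * C q"
      unfolding split[symmetric] by auto
    have nz: "(y(c := t)) i \<noteq> 0" if "i \<in> I" for i using ne I(1) that by (simp only: prod_zero_iff) blast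
    have "y i \<noteq> 0" if "i \<in> I - {c}" for i using nz[of i] that by simp
    hence "C r > 0" for r unfolding C_def by (intro prod_pos) simp
    moreover have "t \<noteq> 0" using nz[OF I(2)] by simp
    ultimately have "\<bar>t\<bar> = s" unfolding s_def using pq eq by (intro abs_eq_of_monomial_relation)
    thus "t \<in> {s, - s}" by auto
  qed
  thus "finite {t. y(c := t) \<in> ?Z}" by (rule finite_subset) simp
qed

lemma null_set_coordinate_hyperplane:
  assumes I: "finite I" "c \<in> I"
  shows "{x \<in> space (\<Pi>\<^sub>M i\<in>I. lborel). x c = (0::real)} \<in> null_sets (\<Pi>\<^sub>M i\<in>I. lborel)"
proof (rule null_sets_PiM_finite_sections[OF I])
  show "{x \<in> space (\<Pi>\<^sub>M i\<in>I. lborel). x c = (0::real)} \<in> sets (\<Pi>\<^sub>M i\<in>I. lborel)"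
    using I(2) by measurable
  show "finite {t. y(c := t) \<in> {x \<in> space (\<Pi>\<^sub>M i\<in>I. lborel). x c = (0::real)}}" for y
    by (rule finite_subset[of _ "{0}"]) auto
qed

text \<open>
  A point of \<open>P G e\<close> outside the admissible set either has a vanishing coordinate or satisfies one of
  the countably many monomial relations with rational exponents. The exponents are restricted to
  \<open>coords G\<close>, as the set of all functions from coordinates to rationals is uncountable.
\<close>

lemma inadmissible_null_set:
  fixes G :: "(nat, 'e) pre_digraph"
  assumes fin: "finite (coords G)"
  shows "P G e - Adm G e \<in> null_sets (lebesgue_coords G)"
proof -
  define M where "M = (\<Pi>\<^sub>M c\<in>coords G. (lborel :: real measure))"
  define \<Q> where "\<Q> = {(p, q). p \<in> coords G \<rightarrow>\<^sub>E (UNIV :: rat set) \<and> q \<in> coords G \<rightarrow>\<^sub>E UNIV \<and> (\<exists>c\<in>coords G. p c \<noteq> q c)}"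
  define Z where "Z p q = {x \<in> space M. (\<Prod>c\<in>coords G. x c) \<noteq> 0 \<and>
      (\<Prod>c\<in>coords G. \<bar>x c\<bar> powr of_rat (p c)) = (\<Prod>c\<in>coords G. \<bar>x c\<bar> powr of_rat (q c))}"
    for p q :: "coord \<Rightarrow> rat"
  define H where "H c = {x \<in> space M. x c = 0}" for c
  have "countable ((coords G \<rightarrow>\<^sub>E (UNIV :: rat set)) \<times> (coords G \<rightarrow>\<^sub>E (UNIV :: rat set)))"
    using fin by (intro countable_SIGMA countable_PiE) auto
  hence cQ: "countable \<Q>" by (rule countable_subset[rotated]) (auto simp: \<Q>_def)
  have Z: "Z p q \<in> null_sets M" if "(p, q) \<in> \<Q>" for p q
  proof -
    have "\<exists>c\<in>coords G. p c \<noteq> q c" using that unfolding \<Q>_def by blast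
    then obtain c where c: "c \<in> coords G" "p c \<noteq> q c" by blast
    show ?thesis unfolding Z_def M_def
      by (rule null_set_monomial_relation[OF fin c(1)]) (use c(2) in simp)
  qed
  have H: "H c \<in> null_sets M" if "c \<in> coords G" for c
    unfolding H_def M_def by (rule null_set_coordinate_hyperplane[OF fin that])
  have "(\<Union>c\<in>coords G. H c) \<union> (\<Union>(p, q)\<in>\<Q>. Z p q) \<in> null_sets M"
  proof (rule null_sets.Un)
    show "(\<Union>c\<in>coords G. H c) \<in> null_sets M"
      by (rule null_sets_UN'[OF countable_finite[OF fin] H])
    show "(\<Union>(p, q)\<in>\<Q>. Z p q) \<in> null_sets M"
      by (rule null_sets_UN'[OF cQ]) (use Z in auto)
  qed
  moreover have "P G e - Adm G e \<subseteq> (\<Union>c\<in>coords G. H c) \<union> (\<Union>(p, q)\<in>\<Q>. Z p q)"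
  proof
    fix x assume x: "x \<in> P G e - Adm G e"
    hence P0: "x \<in> P0 G" by (simp add: P_def)
    hence sp: "x \<in> space M" by (simp add: P0_def M_def space_PiM)
    show "x \<in> (\<Union>c\<in>coords G. H c) \<union> (\<Union>(p, q)\<in>\<Q>. Z p q)"
    proof (cases "\<exists>c\<in>coords G. x c = 0")
      case True
      thus ?thesis using sp by (auto simp: H_def)
    next
      case False
      have "x (Gap i k) > 0" if "i \<in> verts G" "k \<in> {1..out_degree G i - 1}" for i k
      proof -
        have "Gap i k \<in> coords G" using that unfolding coords_def by blast
        moreover have "x (Gap i k) \<ge> 0" using P0 that unfolding P0_def by blast
        ultimately show ?thesis using False by (metis less_eq_real_def)
      qed
      hence "x \<in> P1 G e" using x unfolding P_def P1_def by blast
      hence "\<not> admissible G x" using x unfolding Adm_def by blast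
      then obtain p q :: "coord \<Rightarrow> rat" where pq: "\<exists>c\<in>coords G. p c \<noteq> q c"
        "(\<Prod>c\<in>coords G. \<bar>x c\<bar> powr of_rat (p c)) = (\<Prod>c\<in>coords G. \<bar>x c\<bar> powr of_rat (q c))"
        unfolding admissible_def by blast
      have "(restrict p (coords G), restrict q (coords G)) \<in> \<Q>"
        using pq(1) unfolding \<Q>_def by auto
      moreover have "x \<in> Z (restrict p (coords G)) (restrict q (coords G))"
        using sp False fin pq(2) unfolding Z_def by simp
      ultimately show ?thesis by blast
    qed
  qed
  ultimately show ?thesis
    unfolding lebesgue_coords_def M_def null_sets_completion_iff2 by blast
qed


section \<open>Graph-directed attractors that are not attractors of standard systems\<close>

theorem theorem4p8:
  fixes G :: "(nat, 'e) pre_digraph" and N :: nat and e :: "nat \<Rightarrow> nat \<Rightarrow> 'e" and u :: nat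
  assumes "fin_digraph G"
    and "verts G = {1..N}"
    and "strongly_conn G"
    and "\<forall>w\<in>verts G. out_degree G w \<ge> 2"
    and "edge_ordering G e"
    and "u \<in> verts G"
    and "\<exists>v p. directed_path G v p v \<and> \<not> passes_through G p u"
  shows "(\<forall>x\<in>Adm G e. \<forall>(b :: nat \<Rightarrow> real) F. gd_attractor G (gd_map G e x b) F \<longrightarrow>
            \<not> (\<exists>I. standard_ifs I \<and> COSC I \<and> ifs_attractor I (F u)))
       \<and> P G e - Adm G e \<in> null_sets (lebesgue_coords G)"
proof (intro conjI ballI allI impI notI)
  fix x and b :: "nat \<Rightarrow> real" and F
  assume x: "x \<in> Adm G e" and F: "gd_attractor G (gd_map G e x b) F"
    and "\<exists>I. standard_ifs I \<and> COSC I \<and> ifs_attractor I (F u)"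
  then obtain I where I: "standard_ifs I" "COSC I" "ifs_attractor I (F u)" by blast
  have adm: "x \<in> P1 G e" "admissible G x" using x by (simp_all add: Adm_def)
  interpret interval_system G N e x b F
    by (intro interval_system.intro interval_system_axioms.intro)
      (use assms adm F in simp_all)
  obtain v p where "directed_path G v p v" "\<not> passes_through G p u" using assms(7) by blast
  thus False by (rule attractor_not_COSC[OF adm(2) assms(6,3) _ _ I])
next
  have "finite (coords G)"
  proof (rule card_coords(1)[OF assms(1)])
    show "\<forall>i\<in>verts G. 1 \<le> out_degree G i" using assms(4) by fastforce
  qed
  thus "P G e - Adm G e \<in> null_sets (lebesgue_coords G)" by (rule inadmissible_null_set)
qed

end
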